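(* Let $(\mathcal X,\rho)$ be a Polish space, $p\ge1$, and $\mu\in P_p(\mathcal X)$. Let $(X_i)_{i\ge1}$ be i.i.d. with law $\mu$ and $L_n=\frac1n\sum_{i=1}^n\delta_{X_i}$. Then for all $t>0$, \[\liminf_{n\to\infty}\frac1n\log\mathbb P\big(W_p(L_n,\mu)>t\big)\ge-\inf\{H(\nu\,|\,\mu):\nu\in P_p(\mathcal X),\ W_p(\nu,\mu)>t\}.\]
   Context: $P_p(\mathcal X)$ is the set of Borel probability measures $\nu$ on $\mathcal X$ with $\int\rho(x_o,x)^p\,d\nu(x)<\infty$ for some $x_o$. $\mathcal T_p(\nu_1,\nu_2)=\inf_\pi\int\rho(x,y)^p\,d\pi$ over couplings $\pi$ of $\nu_1,\nu_2$, and $W_p=\mathcal T_p^{1/p}$. $H(\nu\,|\,\mu)=\int\log\frac{d\nu}{d\mu}\,d\nu$ if $\nu\ll\mu$, $+\infty$ otherwise. *)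

theory Defs
  imports "HOL-Probability.Probability"
begin

definition Pp :: "real \<Rightarrow> ('a::metric_space) measure set" where
  "Pp p = {\<nu>. prob_space \<nu> \<and> sets \<nu> = sets borel \<and>
            (\<exists>x0. (\<integral>\<^sup>+ x. ennreal (dist x0 x powr p) \<partial>\<nu>) < \<infinity>)}"

definition couplings :: "('a::topological_space) measure \<Rightarrow> 'a measure \<Rightarrow> ('a \<times> 'a) measure set" where
  "couplings \<nu>1 \<nu>2 = {\<pi>. sets \<pi> = sets (borel \<Otimes>\<^sub>M borel) \<and>
       distr \<pi> borel fst = \<nu>1 \<and> distr \<pi> borel snd = \<nu>2}"

definition Tp :: "real \<Rightarrow> ('a::metric_space) measure \<Rightarrow> 'a measure \<Rightarrow> ennreal" where
  "Tp p \<nu>1 \<nu>2 = (INF \<pi>\<in>couplings \<nu>1 \<nu>2. \<integral>\<^sup>+ z. ennreal (dist (fst z) (snd z) powr p) \<partial>\<pi>)"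

definition Wp :: "real \<Rightarrow> ('a::metric_space) measure \<Rightarrow> 'a measure \<Rightarrow> ereal" where
  "Wp p \<nu>1 \<nu>2 = (if Tp p \<nu>1 \<nu>2 = \<infinity> then \<infinity>
                   else ereal (enn2real (Tp p \<nu>1 \<nu>2) powr (1 / p)))"

text \<open>Relative entropy H(nu|mu) = int log(dnu/dmu) dnu if nu << mu, +infinity otherwise.
  The integral is taken as (positive part) - (negative part) in the extended reals.\<close>
definition rel_entropy :: "'a measure \<Rightarrow> 'a measure \<Rightarrow> ereal" where
  "rel_entropy \<nu> \<mu> =
     (if sets \<nu> = sets \<mu> \<and> absolutely_continuous \<mu> \<nu> then
        enn2ereal (\<integral>\<^sup>+ x. ennreal (ln (enn2real (RN_deriv \<mu> \<nu> x))) \<partial>\<nu>)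
        - enn2ereal (\<integral>\<^sup>+ x. ennreal (- ln (enn2real (RN_deriv \<mu> \<nu> x))) \<partial>\<nu>)
      else \<infinity>)"

definition empirical :: "(nat \<Rightarrow> 'b \<Rightarrow> 'a::topological_space) \<Rightarrow> nat \<Rightarrow> 'b \<Rightarrow> 'a measure" where
  "empirical X n \<omega> = distr (measure_pmf (pmf_of_set {1..n})) borel (\<lambda>i. X i \<omega>)"

definition eln :: "real \<Rightarrow> ereal" where
  "eln x = (if x > 0 then ereal (ln x) else -\<infinity>)"

end

theory Submission
  imports Defs "HOL-Real_Asymp.Real_Asymp"
begin

text \<open>The lower bound of Sanov's theorem by exponential tilting: for \<open>\<nu>\<close> with density \<open>F\<close>
  with respect to \<open>\<mu>\<close>, the law \<open>\<nu>\<^sup>n\<close> has density \<open>\<Prod>i. F (x i)\<close> with respect to \<open>\<mu>\<^sup>n\<close>,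
  which is at most \<open>exp (n (H + \<epsilon>))\<close> on an event of almost full \<open>\<nu>\<^sup>n\<close>-probability. So it suffices
  that \<open>W\<^sub>p(L\<^sub>n, \<mu>) > t\<close> with \<open>\<nu>\<^sup>n\<close>-probability tending to 1. This holds because \<open>\<T>\<^sub>p(\<nu>, L\<^sub>n)\<close>
  becomes small (quantise \<open>\<nu>\<close> by a map with finite range and apply the law of large numbers to the
  finitely many cells) and \<open>\<T>\<^sub>p(\<cdot>, \<mu>)\<close> is lower semicontinuous. The latter is a quasi-triangle
  inequality; since the middle measure \<open>L\<^sub>n\<close> is finitely supported, gluing needs no disintegration.
  The same inequality shows that \<open>W\<^sub>p(L\<^sub>n, \<mu>) > t\<close> is an open condition on the sample, hence
  measurable.\<close>


section \<open>Couplings given by densities, and gluing\<close>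

text \<open>By Tonelli, integrating out the second coordinate leaves the factor 1. The couplings
  built below as densities with respect to product measures get their marginals from this lemma and
  its mirror image. Normalisation is asked only almost everywhere because those densities are
  normalised only off atoms or cells of mass zero.\<close>

lemma distr_fst_density_pair:
  assumes "prob_space M" "prob_space N"
    and h[measurable]: "h \<in> borel_measurable (M \<Otimes>\<^sub>M N)"
    and 1: "AE x in M. (\<integral>\<^sup>+ y. h (x, y) \<partial>N) = 1"
  shows "distr (density (M \<Otimes>\<^sub>M N) h) M fst = M"
proof (rule measure_eqI)
  interpret M: prob_space M by fact
  interpret N: prob_space N by fact
  interpret pair_prob_space M N ..
  fix A assume "A \<in> sets (distr (density (M \<Otimes>\<^sub>M N) h) M fst)"
  then have A[measurable]: "A \<in> sets M" by simp
  have "emeasure (distr (density (M \<Otimes>\<^sub>M N) h) M fst) A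
      = (\<integral>\<^sup>+ x. indicator A x \<partial>distr (density (M \<Otimes>\<^sub>M N) h) M fst)"
    by simp
  also have "\<dots> = (\<integral>\<^sup>+ z. h z * indicator A (fst z) \<partial>(M \<Otimes>\<^sub>M N))"
    by (subst nn_integral_distr, measurable, subst nn_integral_density) auto
  also have "\<dots> = (\<integral>\<^sup>+ x. \<integral>\<^sup>+ y. h (x, y) * indicator A x \<partial>N \<partial>M)"
    by (simp add: N.nn_integral_fst[symmetric])
  also have "\<dots> = (\<integral>\<^sup>+ x. indicator A x \<partial>M)"
    using 1 by (intro nn_integral_cong_AE) (auto simp: nn_integral_multc)
  finally show "emeasure (distr (density (M \<Otimes>\<^sub>M N) h) M fst) A = emeasure M A"
    by simp
qed simp

lemma distr_snd_density_pair:
  assumes "prob_space M" "prob_space N"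
    and h[measurable]: "h \<in> borel_measurable (M \<Otimes>\<^sub>M N)"
    and 1: "AE y in N. (\<integral>\<^sup>+ x. h (x, y) \<partial>M) = 1"
  shows "distr (density (M \<Otimes>\<^sub>M N) h) N snd = N"
proof (rule measure_eqI)
  interpret M: prob_space M by fact
  interpret N: prob_space N by fact
  interpret pair_prob_space M N ..
  fix A assume "A \<in> sets (distr (density (M \<Otimes>\<^sub>M N) h) N snd)"
  then have A[measurable]: "A \<in> sets N" by simp
  have "emeasure (distr (density (M \<Otimes>\<^sub>M N) h) N snd) A
      = (\<integral>\<^sup>+ x. indicator A x \<partial>distr (density (M \<Otimes>\<^sub>M N) h) N snd)"
    by simp
  also have "\<dots> = (\<integral>\<^sup>+ z. h z * indicator A (snd z) \<partial>(M \<Otimes>\<^sub>M N))"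
    by (subst nn_integral_distr, measurable, subst nn_integral_density) auto
  also have "\<dots> = (\<integral>\<^sup>+ y. \<integral>\<^sup>+ x. h (x, y) * indicator A y \<partial>M \<partial>N)"
    by (simp add: nn_integral_snd[symmetric] case_prod_beta')
  also have "\<dots> = (\<integral>\<^sup>+ x. indicator A x \<partial>N)"
    using 1 by (intro nn_integral_cong_AE) (auto simp: nn_integral_multc)
  finally show "emeasure (distr (density (M \<Otimes>\<^sub>M N) h) N snd) A = emeasure N A"
    by simp
qed simp

text \<open>Whichever of \<open>b\<close> and \<open>\<theta> * a\<close> is larger absorbs the
  other. The point is that the weight of \<open>a\<close> tends to 1 as \<open>\<theta>\<close>
  tends to 0; a fixed constant there would be too weak for lower semicontinuity.\<close>

lemma powr_add_le_weighted:
  fixes a b p \<theta> :: real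
  assumes "0 \<le> a" "0 \<le> b" "0 < p" "0 < \<theta>"
  shows "(a + b) powr p \<le> (1 + \<theta>) powr p * a powr p + (1 + 1 / \<theta>) powr p * b powr p"
proof (cases "b \<le> \<theta> * a")
  case True
  then have "(a + b) powr p \<le> ((1 + \<theta>) * a) powr p"
    using assms by (intro powr_mono2) (auto simp: algebra_simps)
  also have "\<dots> = (1 + \<theta>) powr p * a powr p"
    using assms by (simp add: powr_mult)
  finally show ?thesis by (simp add: add_increasing2)
next
  case False
  then have "(a + b) powr p \<le> ((1 + 1 / \<theta>) * b) powr p"
    using assms by (intro powr_mono2) (auto simp: field_simps)
  also have "\<dots> = (1 + 1 / \<theta>) powr p * b powr p"
    using assms by (simp add: powr_mult)
  finally show ?thesis by (simp add: add_increasing)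
qed

lemma couplings_prob_space:
  assumes "\<pi> \<in> couplings \<alpha> \<beta>" "prob_space \<alpha>"
  shows "prob_space \<pi>"
proof -
  have "distr \<pi> borel fst = \<alpha>" and [measurable_cong]: "sets \<pi> = sets (borel \<Otimes>\<^sub>M borel)"
    using assms by (auto simp: couplings_def)
  then show ?thesis
    using assms(2) by (intro prob_space_distrD[of fst \<pi> borel]) auto
qed

lemma Tp_le:
  assumes "\<pi> \<in> couplings \<alpha> \<beta>"
  shows "Tp p \<alpha> \<beta> \<le> (\<integral>\<^sup>+ z. ennreal (dist (fst z) (snd z) powr p) \<partial>\<pi>)"
  unfolding Tp_def using assms by (rule INF_lower)

text \<open>The two couplings are made conditionally independent given their common middle point. As
  \<open>\<beta>\<close> lives on a finite set, this is elementary conditioning on atoms, and the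
  glued law has a density with respect to the product of the couplings.\<close>

lemma Tp_gluing:
  fixes \<alpha> \<beta> \<mu> :: "'a::{metric_space, second_countable_topology} measure"
  assumes "prob_space \<alpha>" "prob_space \<beta>"
    and C: "finite C" "AE x in \<beta>. x \<in> C"
    and \<pi>1: "\<pi>1 \<in> couplings \<alpha> \<beta>" and \<pi>2: "\<pi>2 \<in> couplings \<beta> \<mu>"
    and p: "0 < p" and \<theta>: "0 < \<theta>"
  shows "Tp p \<alpha> \<mu> \<le>
    ennreal ((1 + \<theta>) powr p) * (\<integral>\<^sup>+ z. ennreal (dist (fst z) (snd z) powr p) \<partial>\<pi>2) +
    ennreal ((1 + 1 / \<theta>) powr p) * (\<integral>\<^sup>+ z. ennreal (dist (fst z) (snd z) powr p) \<partial>\<pi>1)"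
proof -
  have m1: "distr \<pi>1 borel fst = \<alpha>" "distr \<pi>1 borel snd = \<beta>"
    and s1[measurable_cong]: "sets \<pi>1 = sets (borel \<Otimes>\<^sub>M borel)"
    using \<pi>1 by (auto simp: couplings_def)
  have m2: "distr \<pi>2 borel fst = \<beta>" "distr \<pi>2 borel snd = \<mu>"
    and s2[measurable_cong]: "sets \<pi>2 = sets (borel \<Otimes>\<^sub>M borel)"
    using \<pi>2 by (auto simp: couplings_def)
  have sb[measurable_cong]: "sets \<beta> = sets borel"
    using m1(2) by auto
  interpret \<beta>: prob_space \<beta> by fact
  interpret \<pi>1: prob_space \<pi>1 using couplings_prob_space[OF \<pi>1] assms by blast
  interpret \<pi>2: prob_space \<pi>2 using couplings_prob_space[OF \<pi>2] assms by blast
  interpret pair_prob_space \<pi>1 \<pi>2 ..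
  \<comment> \<open>Only atoms of positive mass are kept, so that dividing by their mass is
    legitimate; they still carry all of \<open>\<beta>\<close>.\<close>
  define D where "D = {a \<in> C. emeasure \<beta> {a} \<noteq> 0}"
  have [simp]: "finite D" using C by (simp add: D_def)
  then have [measurable]: "D \<in> sets borel" by (intro borel_closed finite_imp_closed)
  have D: "AE x in \<beta>. x \<in> D"
  proof -
    have "AE x in \<beta>. \<forall>a\<in>C - D. x \<noteq> a"
      using C by (intro AE_finite_allI) (auto simp: D_def AE_iff_measurable[OF _ refl] sb sets_eq_imp_space_eq[OF sb])
    with C(2) show ?thesis by eventually_elim auto
  qed
  \<comment> \<open>The gluing density: it selects pairs whose middle points are the same atom
    \<open>a\<close> and renormalises by the mass of \<open>a\<close>, so that integrating out
    either coupling gives 1.\<close>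
  define g :: "('a \<times> 'a) \<times> ('a \<times> 'a) \<Rightarrow> ennreal" where
    "g = (\<lambda>(u, v). \<Sum>a\<in>D. indicator {a} (snd u) * indicator {a} (fst v) / emeasure \<beta> {a})"
  have g[measurable]: "g \<in> borel_measurable (\<pi>1 \<Otimes>\<^sub>M \<pi>2)"
    unfolding g_def by measurable
  have i2: "(\<integral>\<^sup>+ v. indicator {a} (fst v) \<partial>\<pi>2) = emeasure \<beta> {a}" for a
  proof -
    have "emeasure \<beta> {a} = (\<integral>\<^sup>+ x. indicator {a} x \<partial>\<beta>)" by simp
    also have "\<dots> = (\<integral>\<^sup>+ v. indicator {a} (fst v) \<partial>\<pi>2)"
      by (subst m2(1)[symmetric], subst nn_integral_distr) auto
    finally show ?thesis ..
  qed
  have i1: "(\<integral>\<^sup>+ u. indicator {a} (snd u) \<partial>\<pi>1) = emeasure \<beta> {a}" for a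
  proof -
    have "emeasure \<beta> {a} = (\<integral>\<^sup>+ x. indicator {a} x \<partial>\<beta>)" by simp
    also have "\<dots> = (\<integral>\<^sup>+ v. indicator {a} (snd v) \<partial>\<pi>1)"
      by (subst m1(2)[symmetric], subst nn_integral_distr) auto
    finally show ?thesis ..
  qed
  have cancel: "(emeasure \<beta> {a} / emeasure \<beta> {a}) = 1" if "a \<in> D" for a
    using that by (intro ennreal_divide_self) (auto simp: D_def \<beta>.emeasure_eq_measure)
  have g2: "(\<integral>\<^sup>+ v. g (u, v) \<partial>\<pi>2) = (\<Sum>a\<in>D. indicator {a} (snd u))" for u
  proof -
    have "(\<integral>\<^sup>+ v. g (u, v) \<partial>\<pi>2) = (\<Sum>a\<in>D. \<integral>\<^sup>+ v. indicator {a} (snd u) * (indicator {a} (fst v) / emeasure \<beta> {a}) \<partial>\<pi>2)"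
      unfolding g_def prod.case ennreal_times_divide[symmetric] by (rule nn_integral_sum) measurable
    also have "\<dots> = (\<Sum>a\<in>D. indicator {a} (snd u) * (emeasure \<beta> {a} / emeasure \<beta> {a}))"
      by (simp add: nn_integral_cmult nn_integral_divide i2)
    finally show ?thesis by (simp add: cancel cong: sum.cong)
  qed
  have g1: "(\<integral>\<^sup>+ u. g (u, v) \<partial>\<pi>1) = (\<Sum>a\<in>D. indicator {a} (fst v))" for v
  proof -
    have "(\<integral>\<^sup>+ u. g (u, v) \<partial>\<pi>1) = (\<Sum>a\<in>D. \<integral>\<^sup>+ u. indicator {a} (fst v) * (indicator {a} (snd u) / emeasure \<beta> {a}) \<partial>\<pi>1)"
      unfolding g_def prod.case ennreal_times_divide mult.commute[of "indicator {_} (snd _)"] by (rule nn_integral_sum) measurable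
    also have "\<dots> = (\<Sum>a\<in>D. indicator {a} (fst v) * (emeasure \<beta> {a} / emeasure \<beta> {a}))"
      by (simp add: nn_integral_cmult nn_integral_divide i1)
    finally show ?thesis by (simp add: cancel cong: sum.cong)
  qed
  have sD: "(\<Sum>a\<in>D. indicator {a} x) = (1::ennreal)" if "x \<in> D" for x
    using that by (simp add: indicator_def)
  have D1: "AE u in \<pi>1. snd u \<in> D"
    using D by (subst (asm) m1(2)[symmetric], subst (asm) AE_distr_iff) auto
  have D2: "AE v in \<pi>2. fst v \<in> D"
    using D by (subst (asm) m2(1)[symmetric], subst (asm) AE_distr_iff) auto
  have G2: "AE u in \<pi>1. (\<integral>\<^sup>+ v. g (u, v) \<partial>\<pi>2) = 1"
    using D1 by eventually_elim (simp add: g2 sD)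
  have G1: "AE v in \<pi>2. (\<integral>\<^sup>+ u. g (u, v) \<partial>\<pi>1) = 1"
    using D2 by eventually_elim (simp add: g1 sD)
  define Q where "Q = density (\<pi>1 \<Otimes>\<^sub>M \<pi>2) g"
  have [measurable_cong]: "sets Q = sets (\<pi>1 \<Otimes>\<^sub>M \<pi>2)" by (simp add: Q_def)
  have Q1: "distr Q \<pi>1 fst = \<pi>1" unfolding Q_def
    using G2 by (intro distr_fst_density_pair) (auto intro: \<pi>1.prob_space_axioms \<pi>2.prob_space_axioms)
  have Q2: "distr Q \<pi>2 snd = \<pi>2" unfolding Q_def
    using G1 by (intro distr_snd_density_pair) (auto intro: \<pi>1.prob_space_axioms \<pi>2.prob_space_axioms)
  \<comment> \<open>Forgetting the middle point leaves a coupling of the outer marginals.\<close>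
  define \<gamma> where "\<gamma> = distr Q (borel \<Otimes>\<^sub>M borel) (\<lambda>w. (fst (fst w), snd (snd w)))"
  have "distr \<gamma> borel fst = distr (distr Q \<pi>1 fst) borel fst"
    unfolding \<gamma>_def by (subst (1 2) distr_distr) (auto simp: comp_def)
  then have "distr \<gamma> borel fst = \<alpha>" by (simp add: Q1 m1)
  moreover have "distr \<gamma> borel snd = distr (distr Q \<pi>2 snd) borel snd"
    unfolding \<gamma>_def by (subst (1 2) distr_distr) (auto simp: comp_def)
  then have "distr \<gamma> borel snd = \<mu>" by (simp add: Q2 m2)
  ultimately have "\<gamma> \<in> couplings \<alpha> \<mu>"
    by (simp add: couplings_def \<gamma>_def)
  then have "Tp p \<alpha> \<mu> \<le> (\<integral>\<^sup>+ z. ennreal (dist (fst z) (snd z) powr p) \<partial>\<gamma>)"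
    by (rule Tp_le)
  also have "\<dots> = (\<integral>\<^sup>+ w. ennreal (dist (fst (fst w)) (snd (snd w)) powr p) \<partial>Q)"
    unfolding \<gamma>_def by (subst nn_integral_distr) auto
  also have "\<dots> \<le> (\<integral>\<^sup>+ w. ennreal ((1 + \<theta>) powr p) * ennreal (dist (fst (snd w)) (snd (snd w)) powr p)
       + ennreal ((1 + 1 / \<theta>) powr p) * ennreal (dist (fst (fst w)) (snd (fst w)) powr p) \<partial>Q)"
  proof (rule nn_integral_mono_AE)
    \<comment> \<open>\<open>g\<close> vanishes unless the middle points agree, so under
      \<open>Q\<close> the triangle inequality can be applied through the shared point.\<close>
    have "AE w in \<pi>1 \<Otimes>\<^sub>M \<pi>2. 0 < g w \<longrightarrow> snd (fst w) = fst (snd w)"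
    proof (intro AE_I2 impI)
      fix w assume w: "0 < g w"
      show "snd (fst w) = fst (snd w)"
      proof (rule ccontr)
        assume "snd (fst w) \<noteq> fst (snd w)"
        then have "g w = 0"
          by (auto simp: g_def split_beta indicator_def intro!: sum.neutral)
        with w show False by simp
      qed
    qed
    then have "AE w in Q. snd (fst w) = fst (snd w)"
      unfolding Q_def by (subst AE_density) auto
    then show "AE w in Q. ennreal (dist (fst (fst w)) (snd (snd w)) powr p)
      \<le> ennreal ((1 + \<theta>) powr p) * ennreal (dist (fst (snd w)) (snd (snd w)) powr p)
       + ennreal ((1 + 1 / \<theta>) powr p) * ennreal (dist (fst (fst w)) (snd (fst w)) powr p)"
    proof eventually_elim
      fix w :: "('a \<times> 'a) \<times> ('a \<times> 'a)" assume *: "snd (fst w) = fst (snd w)"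
      let ?a = "dist (fst (snd w)) (snd (snd w))" and ?b = "dist (fst (fst w)) (snd (fst w))"
      have "dist (fst (fst w)) (snd (snd w)) powr p \<le> (?a + ?b) powr p"
        using p dist_triangle[of "fst (fst w)" "snd (snd w)" "snd (fst w)"]
        by (intro powr_mono2) (auto simp: *)
      also have "\<dots> \<le> (1 + \<theta>) powr p * ?a powr p + (1 + 1 / \<theta>) powr p * ?b powr p"
        using p \<theta> by (intro powr_add_le_weighted) auto
      finally show "ennreal (dist (fst (fst w)) (snd (snd w)) powr p)
          \<le> ennreal ((1 + \<theta>) powr p) * ennreal (?a powr p) + ennreal ((1 + 1 / \<theta>) powr p) * ennreal (?b powr p)"
        by (simp add: ennreal_mult[symmetric] ennreal_plus[symmetric] ennreal_leI del: ennreal_plus)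
    qed
  qed
  also have "\<dots> = ennreal ((1 + \<theta>) powr p) * (\<integral>\<^sup>+ w. ennreal (dist (fst (snd w)) (snd (snd w)) powr p) \<partial>Q) +
      ennreal ((1 + 1 / \<theta>) powr p) * (\<integral>\<^sup>+ w. ennreal (dist (fst (fst w)) (snd (fst w)) powr p) \<partial>Q)"
    by (subst nn_integral_add, measurable) (simp add: nn_integral_cmult)
  also have "(\<integral>\<^sup>+ w. ennreal (dist (fst (snd w)) (snd (snd w)) powr p) \<partial>Q) =
      (\<integral>\<^sup>+ z. ennreal (dist (fst z) (snd z) powr p) \<partial>\<pi>2)"
    by (subst Q2[symmetric], subst nn_integral_distr) auto
  also have "(\<integral>\<^sup>+ w. ennreal (dist (fst (fst w)) (snd (fst w)) powr p) \<partial>Q) =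
      (\<integral>\<^sup>+ z. ennreal (dist (fst z) (snd z) powr p) \<partial>\<pi>1)"
    by (subst Q1[symmetric], subst nn_integral_distr) auto
  finally show ?thesis .
qed


section \<open>Lower semicontinuity of the transport cost\<close>

text \<open>If the cost from \<open>\<beta>\<close> to \<open>\<mu>\<close> were at most
  \<open>c\<close> while \<open>\<beta>\<close> is close to \<open>\<alpha>\<close>, gluing would
  push the cost from \<open>\<alpha>\<close> to \<open>\<mu>\<close> below its true value. Finite
  support of \<open>\<beta>\<close> is what makes the gluing lemma applicable.\<close>

lemma Tp_lower_semicontinuous:
  fixes \<alpha> \<mu> :: "'a::{metric_space, second_countable_topology} measure"
  assumes "prob_space \<alpha>" and p: "0 < p" and "0 \<le> c" and c: "ennreal c < Tp p \<alpha> \<mu>"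
  obtains \<kappa> :: real where "0 < \<kappa>"
    "\<And>\<beta> C. prob_space \<beta> \<Longrightarrow> finite C \<Longrightarrow> AE x in \<beta>. x \<in> C \<Longrightarrow>
       Tp p \<alpha> \<beta> < ennreal \<kappa> \<Longrightarrow> ennreal c < Tp p \<beta> \<mu>"
proof -
  \<comment> \<open>A finite level \<open>r\<close> is interposed because the cost from
    \<open>\<alpha>\<close> to \<open>\<mu>\<close> may be infinite. The further level
    \<open>c'\<close> above \<open>c\<close> provides a coupling of cost below \<open>c'\<close>, as
    the infimum need not be attained.\<close>
  obtain r where r: "ennreal c < ennreal r" "ennreal r < Tp p \<alpha> \<mu>" "0 \<le> r"
    using dense[OF c] by (metis ennreal_cases not_less top_greatest)
  define c' where "c' = (c + r) / 2"
  have c': "0 \<le> c" "c < c'" "c' < r"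
    using r \<open>0 \<le> c\<close> by (auto simp: c'_def ennreal_less_iff)
  have "((\<lambda>\<theta>. (1 + \<theta>) powr p * c') \<longlongrightarrow> (1 + 0) powr p * c') (at_right 0)"
    by (intro tendsto_intros) auto
  then have "eventually (\<lambda>\<theta>. (1 + \<theta>) powr p * c' < r) (at_right (0::real))"
    using c' by (intro order_tendstoD) auto
  then obtain \<theta> where \<theta>: "0 < \<theta>" "(1 + \<theta>) powr p * c' < r"
    using eventually_happens[OF eventually_conj[OF _ eventually_at_right_less[of 0]]] by (metis trivial_limit_at_right_real)
  define B where "B = (1 + 1 / \<theta>) powr p"
  have "0 < 1 + 1 / \<theta>" using \<theta> by (simp add: add_pos_pos)
  then have B: "0 < B" by (simp add: B_def)
  \<comment> \<open>The room that the choice of \<open>\<theta>\<close> leaves below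
    \<open>r\<close> is spent entirely on the cost between \<open>\<alpha>\<close> and
    \<open>\<beta>\<close>.\<close>
  define \<kappa> where "\<kappa> = (r - (1 + \<theta>) powr p * c') / B"
  have \<kappa>: "0 < \<kappa>" "(1 + \<theta>) powr p * c' + B * \<kappa> = r" using \<theta> B by (auto simp: \<kappa>_def)
  show thesis
  proof (rule that[OF \<kappa>(1)], rule ccontr)
    fix \<beta> :: "'a measure" and C
    assume \<beta>: "prob_space \<beta>" "finite C" "AE x in \<beta>. x \<in> C" "Tp p \<alpha> \<beta> < ennreal \<kappa>"
      and "\<not> ennreal c < Tp p \<beta> \<mu>"
    then have "Tp p \<beta> \<mu> \<le> ennreal c" by simp
    also have "\<dots> < ennreal c'" using c' by (simp add: ennreal_less_iff)
    finally have "Tp p \<beta> \<mu> < ennreal c'" .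
    then obtain \<pi>2 where \<pi>2: "\<pi>2 \<in> couplings \<beta> \<mu>"
      "(\<integral>\<^sup>+ z. ennreal (dist (fst z) (snd z) powr p) \<partial>\<pi>2) < ennreal c'"
      by (auto simp: Tp_def INF_less_iff)
    obtain \<pi>1 where \<pi>1: "\<pi>1 \<in> couplings \<alpha> \<beta>"
      "(\<integral>\<^sup>+ z. ennreal (dist (fst z) (snd z) powr p) \<partial>\<pi>1) < ennreal \<kappa>"
      using \<beta>(4) by (auto simp: Tp_def INF_less_iff)
    have "Tp p \<alpha> \<mu> \<le>
        ennreal ((1 + \<theta>) powr p) * (\<integral>\<^sup>+ z. ennreal (dist (fst z) (snd z) powr p) \<partial>\<pi>2) +
        ennreal B * (\<integral>\<^sup>+ z. ennreal (dist (fst z) (snd z) powr p) \<partial>\<pi>1)"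
      unfolding B_def by (rule Tp_gluing) fact+
    also have "\<dots> \<le> ennreal ((1 + \<theta>) powr p) * ennreal c' + ennreal B * ennreal \<kappa>"
      using \<pi>1(2) \<pi>2(2) by (intro add_mono mult_left_mono) auto
    also have "\<dots> = ennreal r"
      using c' \<kappa> B by (simp add: ennreal_mult[symmetric] ennreal_plus[symmetric] del: ennreal_plus)
    finally show False using r by simp
  qed
qed

section \<open>Empirical measures as functions of the sample\<close>

text \<open>Separating the sample from the random variables allows the same event to be studied
  under product measures and topologically. For \<open>n = 0\<close> the uniform pmf on the empty
  set is unspecified, hence the hypothesis \<open>0 < n\<close> in what follows.\<close>

definition emp :: "nat \<Rightarrow> (nat \<Rightarrow> 'a::topological_space) \<Rightarrow> 'a measure" where
  "emp n x = distr (measure_pmf (pmf_of_set {1..n})) borel x"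

lemma empirical_eq_emp: "empirical X n \<omega> = emp n (\<lambda>i. X i \<omega>)"
  by (simp add: empirical_def emp_def)

lemma emp_cong:
  assumes "0 < n" "\<And>i. i \<in> {1..n} \<Longrightarrow> x i = y i"
  shows "emp n x = emp n y"
  unfolding emp_def using assms
  by (intro distr_cong_AE refl) (auto simp: AE_measure_pmf_iff set_pmf_of_set)

lemma sets_emp [simp, measurable_cong]: "sets (emp n x) = sets borel"
  by (simp add: emp_def)

lemma prob_space_emp: "prob_space (emp n x)"
  unfolding emp_def by (rule prob_space.prob_space_distr) (auto intro: measure_pmf.prob_space_axioms)

lemma AE_emp:
  fixes x :: "nat \<Rightarrow> 'a::t1_space"
  assumes "0 < n"
  shows "AE y in emp n x. y \<in> x ` {1..n}"
proof -
  have "x ` {1..n} \<in> sets borel" by (intro borel_closed finite_imp_closed) auto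
  then show ?thesis unfolding emp_def using assms
    by (subst AE_distr_iff) (auto simp: AE_measure_pmf_iff set_pmf_of_set)
qed

lemma nn_integral_emp:
  assumes "0 < n" and [measurable]: "f \<in> borel_measurable borel"
  shows "(\<integral>\<^sup>+ y. f y \<partial>emp n x) = (\<Sum>i=1..n. f (x i)) / of_nat n"
  using assms unfolding emp_def
  by (subst nn_integral_distr) (auto simp: nn_integral_pmf_of_set)

text \<open>Points with the same index are paired: the coupling is the law of
  \<open>(x i, y i)\<close> for a uniformly chosen index \<open>i\<close>.\<close>

lemma Tp_emp_le:
  fixes x y :: "nat \<Rightarrow> 'a::{metric_space, second_countable_topology}"
  assumes n: "0 < n"
  shows "Tp p (emp n x) (emp n y) \<le> (\<Sum>i=1..n. ennreal (dist (x i) (y i) powr p)) / of_nat n"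
proof -
  let ?M = "measure_pmf (pmf_of_set {1..n})"
  let ?\<pi> = "distr ?M (borel \<Otimes>\<^sub>M borel) (\<lambda>i. (x i, y i))"
  have "?\<pi> \<in> couplings (emp n x) (emp n y)"
    unfolding couplings_def emp_def mem_Collect_eq
    by (subst (1 2) distr_distr) (auto simp: comp_def space_pair_measure)
  then have "Tp p (emp n x) (emp n y) \<le> (\<integral>\<^sup>+ z. ennreal (dist (fst z) (snd z) powr p) \<partial>?\<pi>)"
    by (rule Tp_le)
  also have "\<dots> = (\<Sum>i=1..n. ennreal (dist (x i) (y i) powr p)) / of_nat n"
    using n by (subst nn_integral_distr) (auto simp: nn_integral_pmf_of_set space_pair_measure)
  finally show ?thesis .
qed

text \<open>A small displacement of each of the first \<open>n\<close> points moves the empirical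
  measure little in transport cost, so lower semicontinuity preserves the strict inequality.\<close>

lemma open_Tp_emp:
  fixes \<mu> :: "'a::{metric_space, second_countable_topology} measure"
  assumes n: "0 < n" and p: "0 < p" and c: "0 \<le> c"
  shows "open {x :: nat \<Rightarrow> 'a. ennreal c < Tp p (emp n x) \<mu>}"
proof (rule topological_space_class.openI)
  fix x :: "nat \<Rightarrow> 'a" assume "x \<in> {x. ennreal c < Tp p (emp n x) \<mu>}"
  then have "ennreal c < Tp p (emp n x) \<mu>" by simp
  then obtain \<kappa> :: real where \<kappa>: "0 < \<kappa>" and *: "\<And>\<beta> C. prob_space \<beta> \<Longrightarrow> finite C \<Longrightarrow> AE x in \<beta>. x \<in> C \<Longrightarrow>
       Tp p (emp n x) \<beta> < ennreal \<kappa> \<Longrightarrow> ennreal c < Tp p \<beta> \<mu>"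
    using Tp_lower_semicontinuous[OF prob_space_emp p c, of n x \<mu>] by blast
  \<comment> \<open>Only finitely many coordinates are constrained, so \<open>T\<close> is open in
    the product topology. The radius makes each displacement cost at most
    \<open>\<kappa> / 2\<close>, strictly below \<open>\<kappa>\<close>.\<close>
  define T where "T = (\<Inter>i\<in>{1..n}. {y :: nat \<Rightarrow> 'a. dist (x i) (y i) < (\<kappa> / 2) powr (1 / p)})"
  have "open T" unfolding T_def
    by (intro open_INT ballI open_Collect_less continuous_intros) auto
  moreover have "x \<in> T" using \<kappa> by (simp add: T_def)
  moreover have "T \<subseteq> {x. ennreal c < Tp p (emp n x) \<mu>}"
  proof
    fix y assume y: "y \<in> T"
    have "Tp p (emp n x) (emp n y) \<le> (\<Sum>i=1..n. ennreal (dist (x i) (y i) powr p)) / of_nat n"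
      using n by (rule Tp_emp_le)
    also have "\<dots> \<le> (\<Sum>i=1..n. ennreal (\<kappa> / 2)) / of_nat n"
    proof -
      have "dist (x i) (y i) powr p \<le> \<kappa> / 2" if "i \<in> {1..n}" for i
      proof -
        have "dist (x i) (y i) powr p \<le> ((\<kappa> / 2) powr (1 / p)) powr p"
          using that y p unfolding T_def by (intro powr_mono2) (auto intro: less_imp_le)
        then show ?thesis
          using p \<kappa> by (simp add: powr_powr)
      qed
      then show ?thesis
        by (intro divide_right_mono_ennreal sum_mono ennreal_leI)
    qed
    also have "\<dots> = ennreal (\<kappa> / 2)"
      using n \<kappa> by (simp add: ennreal_of_nat_eq_real_of_nat ennreal_mult[symmetric] divide_ennreal)
    also have "\<dots> < ennreal \<kappa>" using \<kappa> by (simp add: ennreal_less_iff)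
    finally show "y \<in> {x. ennreal c < Tp p (emp n x) \<mu>}"
      using *[OF prob_space_emp _ AE_emp[OF n], of y] by simp
  qed
  ultimately show "\<exists>T. open T \<and> x \<in> T \<and> T \<subseteq> {x. ennreal c < Tp p (emp n x) \<mu>}" by blast
qed

lemma measurable_Tp_emp [measurable]:
  fixes \<mu> :: "'a::{metric_space, second_countable_topology} measure"
  assumes n: "0 < n" and p: "0 < p" and c: "0 \<le> c"
    and [measurable]: "\<And>i. i \<in> {1..n} \<Longrightarrow> (\<lambda>\<omega>. x \<omega> i) \<in> borel_measurable M"
  shows "Measurable.pred M (\<lambda>\<omega>. ennreal c < Tp p (emp n (x \<omega>)) \<mu>)"
proof -
  \<comment> \<open>Openness concerns functions on all of \<open>nat\<close>. Freezing the
    coordinates outside \<open>{1..n}\<close> makes every coordinate measurable without changing the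
    empirical measure, and the countable product sigma-algebra is the Borel one.\<close>
  define y where "y \<omega> = (\<lambda>i. if i \<in> {1..n} then x \<omega> i else undefined)" for \<omega>
  have "(\<lambda>\<omega>. y \<omega> i) \<in> borel_measurable M" for i
    by (cases "i \<in> {1..n}") (auto simp: y_def)
  then have "(\<lambda>\<omega> i. y \<omega> i) \<in> measurable M (\<Pi>\<^sub>M i\<in>UNIV. borel)"
    by (intro measurable_PiM_single') auto
  then have [measurable]: "y \<in> borel_measurable M"
    by (simp add: measurable_cong_sets[OF refl sets_PiM_equal_borel])
  have "emp n (x \<omega>) = emp n (y \<omega>)" for \<omega>
    using n by (intro emp_cong) (auto simp: y_def)
  moreover have [measurable]: "{x :: nat \<Rightarrow> 'a. ennreal c < Tp p (emp n x) \<mu>} \<in> sets borel"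
    using open_Tp_emp[OF n p c] by (rule borel_open)
  have "Measurable.pred M (\<lambda>\<omega>. y \<omega> \<in> {x :: nat \<Rightarrow> 'a. ennreal c < Tp p (emp n x) \<mu>})"
    by measurable
  ultimately show ?thesis by simp
qed


section \<open>Quantisation by maps with finite range\<close>

text \<open>Simple functions converge pointwise to the identity while staying within twice the
  distance to \<open>x0\<close>; the finite moment then permits dominated convergence of the
  quantisation cost.\<close>

lemma finite_range_approximation:
  fixes \<nu> :: "'a::{metric_space, second_countable_topology} measure"
  assumes [measurable_cong]: "sets \<nu> = sets borel" and p: "0 < p"
    and fin: "(\<integral>\<^sup>+ x. ennreal (dist x0 x powr p) \<partial>\<nu>) < \<infinity>" and \<delta>: "0 < \<delta>"
  obtains T :: "'a \<Rightarrow> 'a" where "T \<in> borel_measurable borel" "finite (range T)"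
    "(\<integral>\<^sup>+ x. ennreal (dist x (T x) powr p) \<partial>\<nu>) < \<delta>"
proof -
  obtain F :: "nat \<Rightarrow> 'a \<Rightarrow> 'a" where F: "\<And>i. simple_function borel (F i)"
      "\<And>x. (\<lambda>i. F i x) \<longlonglongrightarrow> x" "\<And>i x. dist (F i x) x0 \<le> 2 * dist x x0"
    using borel_measurable_implies_sequence_metric[of "\<lambda>x. x" borel x0] by auto
  have [measurable]: "F i \<in> borel_measurable borel" for i
    using F(1) by (rule borel_measurable_simple_function)
  have 3: "dist x (F i x) \<le> 3 * dist x0 x" for i x
    using F(3)[of i x] dist_triangle[of x "F i x" x0] by (simp add: dist_commute)
  have "(\<lambda>i. \<integral>\<^sup>+ x. ennreal (dist x (F i x) powr p) \<partial>\<nu>) \<longlonglongrightarrow> (\<integral>\<^sup>+ x. 0 \<partial>\<nu>)"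
  proof (rule nn_integral_dominated_convergence)
    show "(\<integral>\<^sup>+ x. ennreal (3 powr p) * ennreal (dist x0 x powr p) \<partial>\<nu>) < \<infinity>"
      using fin by (subst nn_integral_cmult) (auto simp: ennreal_mult_less_top)
    show "AE x in \<nu>. ennreal (dist x (F i x) powr p) \<le> ennreal (3 powr p) * ennreal (dist x0 x powr p)" for i
      using 3 p by (intro AE_I2) (auto simp: ennreal_mult[symmetric] powr_mult[symmetric] intro!: ennreal_leI powr_mono2)
    show "AE x in \<nu>. (\<lambda>i. ennreal (dist x (F i x) powr p)) \<longlonglongrightarrow> 0"
    proof (rule AE_I2)
      fix x
      have "(\<lambda>i. dist x (F i x)) \<longlonglongrightarrow> dist x x"
        by (intro tendsto_intros F)
      then have "(\<lambda>i. dist x (F i x) powr p) \<longlonglongrightarrow> 0"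
        using p by (intro tendsto_zero_powrI[where b = p]) auto
      then show "(\<lambda>i. ennreal (dist x (F i x) powr p)) \<longlonglongrightarrow> 0"
        using tendsto_ennrealI by fastforce
    qed
  qed measurable
  then have "eventually (\<lambda>i. (\<integral>\<^sup>+ x. ennreal (dist x (F i x) powr p) \<partial>\<nu>) < \<delta>) sequentially"
    using \<delta> by (auto intro: order_tendstoD)
  then obtain i where "(\<integral>\<^sup>+ x. ennreal (dist x (F i x) powr p) \<partial>\<nu>) < \<delta>"
    using eventually_happens[of _ sequentially] by auto
  moreover have "finite (range (F i))"
    using simple_functionD(1)[OF F(1)[of i]] by simp
  ultimately show thesis by (intro that) auto
qed

section \<open>Comparing measures through the cells of a finite partition\<close>

lemma nn_integral_finite_range:
  assumes "finite_measure M" and [measurable]: "T \<in> measurable M borel"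
    and C: "finite C" "range T \<subseteq> C" and k: "\<And>a. a \<in> C \<Longrightarrow> 0 \<le> k a"
  shows "(\<integral>\<^sup>+ x. ennreal (k (T x)) \<partial>M) = ennreal (\<Sum>a\<in>C. k a * measure M (T -` {a::'b::t1_space} \<inter> space M))"
proof -
  interpret finite_measure M by fact
  have "(\<integral>\<^sup>+ x. ennreal (k (T x)) \<partial>M) = (\<integral>\<^sup>+ x. (\<Sum>a\<in>C. ennreal (k a) * indicator (T -` {a} \<inter> space M) x) \<partial>M)"
  proof (rule nn_integral_cong)
    fix x assume "x \<in> space M"
    then have "(\<Sum>a\<in>C. ennreal (k a) * indicator (T -` {a} \<inter> space M) x) = (\<Sum>a\<in>C. if a = T x then ennreal (k a) else 0)"
      by (intro sum.cong) (auto simp: indicator_def)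
    also have "\<dots> = ennreal (k (T x))"
      using C by auto
    finally show "ennreal (k (T x)) = (\<Sum>a\<in>C. ennreal (k a) * indicator (T -` {a} \<inter> space M) x)" ..
  qed
  also have "\<dots> = (\<Sum>a\<in>C. ennreal (k a) * emeasure M (T -` {a} \<inter> space M))"
    by (subst nn_integral_sum) (auto simp: nn_integral_cmult_indicator)
  also have "\<dots> = (\<Sum>a\<in>C. ennreal (k a * measure M (T -` {a} \<inter> space M)))"
    using k by (intro sum.cong) (auto simp: emeasure_eq_measure ennreal_mult)
  also have "\<dots> = ennreal (\<Sum>a\<in>C. k a * measure M (T -` {a} \<inter> space M))"
    using k by (intro sum_ennreal) auto
  finally show ?thesis .
qed

text \<open>The fibres of measure zero are finitely many, so their union is null. This makes
  division by cell masses harmless in the coupling below.\<close>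

lemma AE_measure_fibre_pos:
  assumes "finite_measure M" and [measurable]: "T \<in> measurable M borel"
    and C: "finite C" "range T \<subseteq> C"
  shows "AE x in M. 0 < measure M (T -` {T x::'b::t1_space} \<inter> space M)"
proof -
  interpret finite_measure M by fact
  have "AE x in M. \<forall>a\<in>{a\<in>C. measure M (T -` {a} \<inter> space M) = 0}. T x \<noteq> a"
  proof (rule AE_finite_allI)
    fix a assume "a \<in> {a\<in>C. measure M (T -` {a} \<inter> space M) = 0}"
    then have "T -` {a} \<inter> space M \<in> null_sets M"
      by (auto simp: null_sets_def emeasure_eq_measure)
    then show "AE x in M. T x \<noteq> a"
      by (rule AE_I') auto
  qed (use C in auto)
  then show ?thesis
    by eventually_elim (use C in \<open>auto simp: zero_less_measure_iff\<close>)
qed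

lemma sum_powr_le:
  fixes a b c p :: real
  assumes "0 \<le> a" "0 \<le> b" "0 \<le> c" "0 < p"
  shows "(a + b + c) powr p \<le> 3 powr p * (a powr p + b powr p + c powr p)"
proof -
  let ?m = "max a (max b c)"
  have "(a + b + c) powr p \<le> (3 * ?m) powr p"
    using assms by (intro powr_mono2) (auto simp: max_def)
  also have "\<dots> = 3 powr p * ?m powr p"
    using assms by (simp add: powr_mult)
  also have "?m powr p \<le> a powr p + b powr p + c powr p"
    by (auto simp: max_def)
  finally show ?thesis by simp
qed

text \<open>The coupling keeps a fraction \<open>1 - \<eta>\<close> of the mass of \<open>\<nu>\<close> inside its own cell
  \<open>{T = a}\<close> and spreads the remaining mass independently.\<close>
lemma Tp_le_cells:
  fixes \<nu> \<beta> :: "'a::{metric_space, second_countable_topology} measure"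
  assumes "prob_space \<nu>" "prob_space \<beta>"
    and s\<nu>[measurable_cong]: "sets \<nu> = sets borel" and s\<beta>[measurable_cong]: "sets \<beta> = sets borel"
    and T[measurable]: "T \<in> borel_measurable borel" and C: "finite (range T)"
    and p: "0 < p" and \<eta>: "0 \<le> \<eta>" "\<eta> < 1"
    and cells: "\<And>a. a \<in> range T \<Longrightarrow> (1 - \<eta>) * measure \<nu> (T -` {a}) \<le> measure \<beta> (T -` {a})"
    and D: "\<And>a b. a \<in> range T \<Longrightarrow> b \<in> range T \<Longrightarrow> dist a b powr p \<le> D"
  shows "Tp p \<nu> \<beta> \<le> ennreal (3 powr p) *
    ((\<integral>\<^sup>+ x. ennreal (dist x (T x) powr p) \<partial>\<nu>) + ennreal (D * \<eta>) + (\<integral>\<^sup>+ y. ennreal (dist y (T y) powr p) \<partial>\<beta>))"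
proof -
  interpret \<nu>: prob_space \<nu> by fact
  interpret \<beta>: prob_space \<beta> by fact
  interpret pair_prob_space \<nu> \<beta> ..
  have sp[simp]: "space \<nu> = UNIV" "space \<beta> = UNIV"
    using s\<nu> s\<beta> by (auto dest: sets_eq_imp_space_eq)
  define C where "C = range T"
  have finC[simp]: "finite C" and TC[simp]: "T x \<in> C" "range T \<subseteq> C" for x
    using C by (auto simp: C_def)
  define w q where "w a = measure \<nu> (T -` {a})" and "q a = measure \<beta> (T -` {a})" for a
  have w0: "0 \<le> w a" and q0: "0 \<le> q a" for a by (auto simp: w_def q_def)
  have D0: "0 \<le> D" using D[of "T undefined" "T undefined"] p by simp
  have int\<nu>: "(\<integral>\<^sup>+ x. ennreal (k (T x)) \<partial>\<nu>) = ennreal (\<Sum>a\<in>C. k a * w a)" if "\<And>a. a \<in> C \<Longrightarrow> 0 \<le> k a" for k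
    using nn_integral_finite_range[OF \<nu>.finite_measure_axioms _ finC _ that, of T] by (simp add: w_def)
  have int\<beta>: "(\<integral>\<^sup>+ x. ennreal (k (T x)) \<partial>\<beta>) = ennreal (\<Sum>a\<in>C. k a * q a)" if "\<And>a. a \<in> C \<Longrightarrow> 0 \<le> k a" for k
    using nn_integral_finite_range[OF \<beta>.finite_measure_axioms _ finC _ that, of T] by (simp add: q_def)
  have sumw: "(\<Sum>a\<in>C. w a) = 1"
    using int\<nu>[of "\<lambda>_. 1"] \<nu>.emeasure_space_1 w0 by (simp add: sum_nonneg)
  have sumq: "(\<Sum>a\<in>C. q a) = 1"
    using int\<beta>[of "\<lambda>_. 1"] \<beta>.emeasure_space_1 q0 by (simp add: sum_nonneg)
  have wq: "(1 - \<eta>) * w a \<le> q a" if "a \<in> C" for a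
    using cells[of a] that by (auto simp: w_def q_def C_def)
  have q0w: "w a = 0" if "a \<in> C" "q a = 0" for a
    using wq[OF that(1)] that(2) \<eta> w0[of a] by (auto simp: mult_le_0_iff)
  define s where "s b = (q b - (1 - \<eta>) * w b) / q b" for b
  have s0: "0 \<le> s b" if "b \<in> C" for b
    using wq[OF that] q0[of b] by (simp add: s_def)
  have sq: "s b * q b = q b - (1 - \<eta>) * w b" if "b \<in> C" for b
    using q0w[OF that] by (cases "q b = 0") (auto simp: s_def)
  have sumsq: "(\<Sum>b\<in>C. s b * q b) = \<eta>"
    by (simp add: sq sum_subtractf sum_distrib_left[symmetric] sumw sumq)
  \<comment> \<open>The density depends on the cells only. Its diagonal term places mass
    \<open>(1 - \<eta>) * w a\<close> on the square of cell \<open>a\<close>; the term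
    \<open>s b\<close>, free of \<open>a\<close>, is the independent coupling with the excess mass,
    of total \<open>\<eta>\<close>.\<close>
  define k where "k a b = (if a = b then (1 - \<eta>) / q a else 0) + s b" for a b
  have k0: "0 \<le> k a b" if "b \<in> C" for a b
    using s0[OF that] q0 \<eta> by (auto simp: k_def)
  have k1: "(\<Sum>b\<in>C. k a b * q b) = 1" if "a \<in> C" "0 < q a" for a
  proof -
    have "(\<Sum>b\<in>C. k a b * q b) = (\<Sum>b\<in>C. (if a = b then 1 - \<eta> else 0) + s b * q b)"
      using that by (intro sum.cong) (auto simp: k_def distrib_right)
    also have "\<dots> = 1" using that by (simp only: sum.distrib sumsq) simp
    finally show ?thesis .
  qed
  have k2: "(\<Sum>a\<in>C. k a b * w a) = 1" if "b \<in> C" "0 < q b" for b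
  proof -
    have "(\<Sum>a\<in>C. k a b * w a) = (\<Sum>a\<in>C. (if a = b then (1 - \<eta>) / q b * w b else 0) + s b * w a)"
      by (intro sum.cong) (auto simp: k_def algebra_simps)
    also have "\<dots> = (1 - \<eta>) / q b * w b + s b"
      using that by (simp add: sum.distrib sum_distrib_left[symmetric] sumw)
    also have "\<dots> = 1" using that by (simp add: s_def field_simps)
    finally show ?thesis .
  qed
  define h where "h = (\<lambda>z. ennreal (k (T (fst z)) (T (snd z))))"
  have h[measurable]: "h \<in> borel_measurable (\<nu> \<Otimes>\<^sub>M \<beta>)"
  proof -
    \<comment> \<open>\<open>k\<close> is an arbitrary function of two points; measurability comes
      from writing \<open>h\<close> as a finite combination of indicators of cell products.\<close>
    have "h z = (\<Sum>a\<in>C. \<Sum>b\<in>C. ennreal (k a b) * (indicator {a} (T (fst z)) * indicator {b} (T (snd z))))" for z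
    proof -
      have "(\<Sum>a\<in>C. \<Sum>b\<in>C. ennreal (k a b) * (indicator {a} (T (fst z)) * indicator {b} (T (snd z))))
          = (\<Sum>a\<in>C. if a = T (fst z) then (\<Sum>b\<in>C. if b = T (snd z) then ennreal (k a b) else 0) else 0)"
        by (intro sum.cong refl) (auto simp: indicator_def intro!: sum.cong)
      then show ?thesis by (simp add: h_def)
    qed
    then have "h = (\<lambda>z. \<Sum>a\<in>C. \<Sum>b\<in>C. ennreal (k a b) * (indicator {a} (T (fst z)) * indicator {b} (T (snd z))))"
      by (rule ext)
    then show ?thesis by simp
  qed
  have q\<beta>: "AE y in \<beta>. 0 < q (T y)"
    using AE_measure_fibre_pos[OF \<beta>.finite_measure_axioms _ finC, of T] by (simp add: q_def)
  have "AE x in \<nu>. 0 < w (T x)"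
    using AE_measure_fibre_pos[OF \<nu>.finite_measure_axioms _ finC, of T] by (simp add: w_def)
  then have q\<nu>: "AE x in \<nu>. 0 < q (T x)"
    by eventually_elim (use q0w q0 TC in \<open>metis less_le\<close>)
  define \<pi> where "\<pi> = density (\<nu> \<Otimes>\<^sub>M \<beta>) h"
  have s\<pi>[measurable_cong]: "sets \<pi> = sets (borel \<Otimes>\<^sub>M borel)"
    unfolding \<pi>_def sets_density by (intro sets_pair_measure_cong s\<nu> s\<beta>)
  have "AE x in \<nu>. (\<integral>\<^sup>+ y. h (x, y) \<partial>\<beta>) = 1"
    using q\<nu> by eventually_elim (simp add: h_def int\<beta> k0 k1)
  then have \<pi>1: "distr \<pi> \<nu> fst = \<nu>" unfolding \<pi>_def
    by (intro distr_fst_density_pair) (auto intro: \<nu>.prob_space_axioms \<beta>.prob_space_axioms)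
  have "AE y in \<beta>. (\<integral>\<^sup>+ x. h (x, y) \<partial>\<nu>) = 1"
    using q\<beta> by eventually_elim (simp add: h_def int\<nu>[of "\<lambda>a. k a (T _)"] k0 k2)
  then have \<pi>2: "distr \<pi> \<beta> snd = \<beta>" unfolding \<pi>_def
    by (intro distr_snd_density_pair) (auto intro: \<nu>.prob_space_axioms \<beta>.prob_space_axioms)
  have "\<pi> \<in> couplings \<nu> \<beta>"
    using \<pi>1 \<pi>2 by (simp add: couplings_def s\<pi> distr_cong[OF refl s\<nu>] distr_cong[OF refl s\<beta>])
  then have "Tp p \<nu> \<beta> \<le> (\<integral>\<^sup>+ z. ennreal (dist (fst z) (snd z) powr p) \<partial>\<pi>)"
    by (rule Tp_le)
  also have "\<dots> \<le> (\<integral>\<^sup>+ z. ennreal (3 powr p) * (ennreal (dist (fst z) (T (fst z)) powr p) +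
      ennreal (dist (T (fst z)) (T (snd z)) powr p) + ennreal (dist (snd z) (T (snd z)) powr p)) \<partial>\<pi>)"
  proof (rule nn_integral_mono)
    fix z :: "'a \<times> 'a"
    let ?a = "dist (fst z) (T (fst z))" and ?b = "dist (T (fst z)) (T (snd z))" and ?c = "dist (snd z) (T (snd z))"
    have "dist (fst z) (snd z) powr p \<le> (?a + ?b + ?c) powr p"
      using p dist_triangle[of "fst z" "snd z" "T (fst z)"] dist_triangle[of "T (fst z)" "snd z" "T (snd z)"]
      by (intro powr_mono2) (auto simp: dist_commute)
    also have "\<dots> \<le> 3 powr p * (?a powr p + ?b powr p + ?c powr p)"
      using p by (intro sum_powr_le) auto
    finally show "ennreal (dist (fst z) (snd z) powr p) \<le> ennreal (3 powr p) * (ennreal (?a powr p) + ennreal (?b powr p) + ennreal (?c powr p))"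
      by (simp add: ennreal_mult[symmetric] ennreal_plus[symmetric] ennreal_leI del: ennreal_plus)
  qed
  also have "\<dots> = ennreal (3 powr p) * ((\<integral>\<^sup>+ z. ennreal (dist (fst z) (T (fst z)) powr p) \<partial>\<pi>) +
      (\<integral>\<^sup>+ z. ennreal (dist (T (fst z)) (T (snd z)) powr p) \<partial>\<pi>) +
      (\<integral>\<^sup>+ z. ennreal (dist (snd z) (T (snd z)) powr p) \<partial>\<pi>))"
    by (simp add: nn_integral_cmult nn_integral_add)
  also have "(\<integral>\<^sup>+ z. ennreal (dist (fst z) (T (fst z)) powr p) \<partial>\<pi>) = (\<integral>\<^sup>+ x. ennreal (dist x (T x) powr p) \<partial>\<nu>)"
    by (subst \<pi>1[symmetric], subst nn_integral_distr) auto
  also have "(\<integral>\<^sup>+ z. ennreal (dist (snd z) (T (snd z)) powr p) \<partial>\<pi>) = (\<integral>\<^sup>+ x. ennreal (dist x (T x) powr p) \<partial>\<beta>)"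
    by (subst \<pi>2[symmetric], subst nn_integral_distr) auto
  also have "(\<integral>\<^sup>+ z. ennreal (dist (T (fst z)) (T (snd z)) powr p) \<partial>\<pi>) \<le> ennreal (D * \<eta>)"
  proof -
    have "(\<integral>\<^sup>+ z. ennreal (dist (T (fst z)) (T (snd z)) powr p) \<partial>\<pi>)
        = (\<integral>\<^sup>+ z. h z * ennreal (dist (T (fst z)) (T (snd z)) powr p) \<partial>(\<nu> \<Otimes>\<^sub>M \<beta>))"
      unfolding \<pi>_def by (rule nn_integral_density) measurable
    also have "\<dots> = (\<integral>\<^sup>+ x. \<integral>\<^sup>+ y. h (x, y) * ennreal (dist (T x) (T y) powr p) \<partial>\<beta> \<partial>\<nu>)"
      by (subst \<beta>.nn_integral_fst[symmetric]) auto
    also have "\<dots> \<le> (\<integral>\<^sup>+ x. \<integral>\<^sup>+ y. ennreal (D * s (T y)) \<partial>\<beta> \<partial>\<nu>)"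
    proof (intro nn_integral_mono)
      fix x y
      \<comment> \<open>Inside one cell the distance between representatives is zero, and across
        cells only the excess term \<open>s\<close> of \<open>k\<close> survives; hence the bound by
        \<open>D\<close> times the excess mass.\<close>
      have "k (T x) (T y) * (dist (T x) (T y) powr p) \<le> s (T y) * D"
      proof (cases "T x = T y")
        case True then show ?thesis using p s0[of "T y"] D0 by simp
      next
        case False
        then show ?thesis using s0[of "T y"] D[of "T x" "T y"] by (auto simp: k_def intro!: mult_left_mono)
      qed
      then show "h (x, y) * ennreal (dist (T x) (T y) powr p) \<le> ennreal (D * s (T y))"
        using k0[of "T y" "T x"] by (simp add: h_def ennreal_mult[symmetric] ennreal_leI mult.commute)
    qed
    also have "\<dots> = ennreal (D * \<eta>)"
      using int\<beta>[of "\<lambda>a. D * s a"] s0 D0 \<nu>.emeasure_space_1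
      by (simp add: mult.assoc sum_distrib_left[symmetric] sumsq)
    finally show ?thesis .
  qed
  finally show ?thesis
    by (simp add: add_left_mono add_right_mono mult_left_mono)
qed


section \<open>The weak law of large numbers on product spaces\<close>

lemma indep_vars_PiM_coordinates:
  assumes "prob_space M" "finite I" and ne: "I \<noteq> {}" and f[measurable]: "f \<in> borel_measurable M"
  shows "prob_space.indep_vars (\<Pi>\<^sub>M i\<in>I. M) (\<lambda>_. borel) (\<lambda>i x. f (x i) :: real) I"
proof -
  interpret P: prob_space "\<Pi>\<^sub>M i\<in>I. M" using assms by (intro prob_space_PiM)
  have "P.indep_vars (\<lambda>_. M) (\<lambda>i x. x i) I"
  proof (subst P.indep_vars_iff_distr_eq_PiM'[OF ne])
    have "distr (\<Pi>\<^sub>M i\<in>I. M) (\<Pi>\<^sub>M i\<in>I. M) (\<lambda>x. \<lambda>i\<in>I. x i) = distr (\<Pi>\<^sub>M i\<in>I. M) (\<Pi>\<^sub>M i\<in>I. M) (\<lambda>x. x)"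
      by (intro distr_cong refl) (auto simp: space_PiM PiE_def extensional_restrict)
    also have "\<dots> = (\<Pi>\<^sub>M i\<in>I. M)" by simp
    also have "\<dots> = (\<Pi>\<^sub>M i\<in>I. distr (\<Pi>\<^sub>M i\<in>I. M) M (\<lambda>x. x i))"
      using assms by (intro PiM_cong refl distr_PiM_component[symmetric]) auto
    finally show "distr (\<Pi>\<^sub>M i\<in>I. M) (\<Pi>\<^sub>M i\<in>I. M) (\<lambda>x. \<lambda>i\<in>I. x i) = (\<Pi>\<^sub>M i\<in>I. distr (\<Pi>\<^sub>M i\<in>I. M) M (\<lambda>x. x i))" .
  qed auto
  then show ?thesis by (rule P.indep_vars_compose2) auto
qed

text \<open>Clamping \<open>f\<close> to growing symmetric intervals converges pointwise, with error
  dominated by a multiple of \<open>\<bar>f x\<bar>\<close>. The levels start at 1 so that the bound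
  \<open>K\<close> is positive.\<close>

lemma (in prob_space) truncation_L1:
  assumes f: "integrable M (f :: 'a \<Rightarrow> real)" and "0 < e"
  obtains g K where "integrable M g" "0 < K" "\<And>x. \<bar>g x\<bar> \<le> K" "(\<integral>x. \<bar>f x - g x\<bar> \<partial>M) < e"
proof -
  have [measurable]: "f \<in> borel_measurable M" using f by auto
  define g where "g k x = max (- real (Suc k)) (min (real (Suc k)) (f x))" for k x
  have "(\<lambda>k. \<integral>x. \<bar>f x - g k x\<bar> \<partial>M) \<longlonglongrightarrow> (\<integral>x. 0 \<partial>M)"
  proof (rule integral_dominated_convergence[where w = "\<lambda>x. 2 * \<bar>f x\<bar>"])
    show "AE x in M. (\<lambda>k. \<bar>f x - g k x\<bar>) \<longlonglongrightarrow> 0"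
    proof (rule AE_I2)
      fix x
      obtain N where N: "\<bar>f x\<bar> \<le> real N" using real_arch_simple by blast
      have "\<bar>f x - g k x\<bar> = 0" if "k \<ge> N" for k
      proof -
        have "\<bar>f x\<bar> \<le> real (Suc k)" using N that by simp
        then show ?thesis by (auto simp: g_def max_def min_def)
      qed
      then show "(\<lambda>k. \<bar>f x - g k x\<bar>) \<longlonglongrightarrow> 0"
        by (intro tendsto_eventually eventually_sequentiallyI)
    qed
    show "AE x in M. norm \<bar>f x - g k x\<bar> \<le> 2 * \<bar>f x\<bar>" for k
      by (intro AE_I2) (auto simp: g_def max_def min_def)
  qed (use f in \<open>auto simp: g_def\<close>)
  then have "eventually (\<lambda>k. (\<integral>x. \<bar>f x - g k x\<bar> \<partial>M) < e) sequentially"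
    using \<open>0 < e\<close> by (intro order_tendstoD) auto
  then obtain k where "(\<integral>x. \<bar>f x - g k x\<bar> \<partial>M) < e"
    using eventually_happens[of _ sequentially] by auto
  moreover have "integrable M (g k)"
    by (rule integrable_const_bound[of _ "real (Suc k)"]) (auto simp: g_def[abs_def])
  ultimately show thesis
    by (intro that[of "g k" "real (Suc k)"]) (auto simp: g_def max_def min_def)
qed

text \<open>Hoeffding's inequality for i.i.d. values in \<open>{- K..K}\<close> gives an
  exponentially small bound for every \<open>n \<ge> 1\<close>.\<close>

lemma weak_law_bounded:
  assumes "prob_space M" and [measurable]: "g \<in> borel_measurable M" and K: "0 < K" "\<And>x. \<bar>g x\<bar> \<le> K" and e: "0 < e"
  shows "(\<lambda>n. measure (\<Pi>\<^sub>M i\<in>{1..n}. M) {x \<in> space (\<Pi>\<^sub>M i\<in>{1..n}. M).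
     e \<le> \<bar>(\<Sum>i=1..n. g (x i)) / real n - (\<integral>y. g y \<partial>M)\<bar>}) \<longlonglongrightarrow> 0"
proof (rule tendsto_sandwich[where f = "\<lambda>_. 0"])
  interpret M: prob_space M by fact
  show "(\<lambda>n. 2 * exp (-2 * real n * e\<^sup>2 / (K - -K)\<^sup>2)) \<longlonglongrightarrow> 0"
    using e K by real_asymp
  show "eventually (\<lambda>n. measure (\<Pi>\<^sub>M i\<in>{1..n}. M) {x \<in> space (\<Pi>\<^sub>M i\<in>{1..n}. M).
     e \<le> \<bar>(\<Sum>i=1..n. g (x i)) / real n - (\<integral>y. g y \<partial>M)\<bar>} \<le> 2 * exp (-2 * real n * e\<^sup>2 / (K - -K)\<^sup>2)) sequentially"
  proof (rule eventually_sequentiallyI[of 1])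
    fix n :: nat assume n: "1 \<le> n"
    define P where "P = (\<Pi>\<^sub>M i\<in>{1..n}. M)"
    interpret P: prob_space P unfolding P_def using assms by (intro prob_space_PiM)
    have d: "distr P M (\<lambda>x. x i) = M" if "i \<in> {1..n}" for i
      unfolding P_def using that assms by (intro distr_PiM_component) auto
    have m[measurable]: "(\<lambda>x. x i) \<in> measurable P M" if "i \<in> {1..n}" for i
      using that by (auto simp: P_def)
    have d': "distr P borel (\<lambda>x. g (x i)) = distr M borel g" if "i \<in> {1..n}" for i
    proof -
      have "distr P borel (\<lambda>x. g (x i)) = distr (distr P M (\<lambda>x. x i)) borel g"
        using that m by (subst distr_distr) (auto simp: comp_def)
      then show ?thesis by (simp add: d[OF that])
    qed
    interpret H: Hoeffding_ineq_iid P "{1..n}" "\<lambda>i x. g (x i)" "\<lambda>x. g (x 1)" "-K" K "\<integral>y. g y \<partial>M"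
    proof unfold_locales
      show "P.indep_vars (\<lambda>_. borel) (\<lambda>i x. g (x i)) {1..n}"
        unfolding P_def using assms n by (intro indep_vars_PiM_coordinates) auto
      show "distr P borel (\<lambda>x. g (x i)) = distr P borel (\<lambda>x. g (x 1))" if "i \<in> {1..n}" for i
        using d'[OF that] d'[of 1] n by simp
      show [measurable]: "(\<lambda>x. g (x 1)) \<in> borel_measurable P"
        using n m[of 1] by simp
      show "AE x in P. g (x 1) \<in> {- K..K}"
        using K(2) by (auto simp: abs_le_iff minus_le_iff)
      have "(\<integral>x. g (x 1) \<partial>P) = (\<integral>y. g y \<partial>distr P M (\<lambda>x. x 1))"
        using n m[of 1] by (subst integral_distr) auto
      then have "(\<integral>y. g y \<partial>M) = (\<integral>x. g (x 1) \<partial>P)"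
        using n d[of 1] by simp
      then show "(\<integral>y. g y \<partial>M) \<equiv> (\<integral>x. g (x 1) \<partial>P)" by simp
    qed auto
    show "measure (\<Pi>\<^sub>M i\<in>{1..n}. M) {x \<in> space (\<Pi>\<^sub>M i\<in>{1..n}. M).
     e \<le> \<bar>(\<Sum>i=1..n. g (x i)) / real n - (\<integral>y. g y \<partial>M)\<bar>} \<le> 2 * exp (-2 * real n * e\<^sup>2 / (K - -K)\<^sup>2)"
      using H.Hoeffding_ineq_abs_ge'[of e] e K n unfolding P_def by simp
  qed
qed auto

text \<open>Markov's inequality, since each coordinate has law \<open>M\<close> and the average
  therefore has the mean of a single term. The bound is uniform in \<open>n\<close>, which suits the
  truncation remainder.\<close>

lemma mean_Markov_PiM:
  assumes "prob_space M" and r: "integrable M (r :: 'a \<Rightarrow> real)" and e: "0 < e" and n: "0 < n"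
  shows "measure (\<Pi>\<^sub>M i\<in>{1..n}. M) {x \<in> space (\<Pi>\<^sub>M i\<in>{1..n}. M). e \<le> (\<Sum>i=1..n. \<bar>r (x i)\<bar>) / real n}
     \<le> (\<integral>y. \<bar>r y\<bar> \<partial>M) / e"
proof -
  interpret M: prob_space M by fact
  define P where "P = (\<Pi>\<^sub>M i\<in>{1..n}. M)"
  interpret P: prob_space P unfolding P_def using assms by (intro prob_space_PiM)
  have d: "distr P M (\<lambda>x. x i) = M" if "i \<in> {1..n}" for i
    unfolding P_def using that assms by (intro distr_PiM_component) auto
  have m[measurable]: "(\<lambda>x. x i) \<in> measurable P M" if "i \<in> {1..n}" for i
    using that by (auto simp: P_def)
  have i1: "integrable P (\<lambda>x. \<bar>r (x i)\<bar>)" if "i \<in> {1..n}" for i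
    using integrable_distr[of "\<lambda>x. x i" P M "\<lambda>y. \<bar>r y\<bar>"] that m r d by simp
  have i2: "(\<integral>x. \<bar>r (x i)\<bar> \<partial>P) = (\<integral>y. \<bar>r y\<bar> \<partial>M)" if "i \<in> {1..n}" for i
    using integral_distr[of "\<lambda>x. x i" P M "\<lambda>y. \<bar>r y\<bar>"] that m r d by simp
  have "P.prob {x \<in> space P. e \<le> (\<Sum>i=1..n. \<bar>r (x i)\<bar>) / real n} \<le> (\<integral>x. (\<Sum>i=1..n. \<bar>r (x i)\<bar>) / real n \<partial>P) / e"
    using i1 e by (intro integral_Markov_inequality_measure[where A = "{}"] integrable_divide_zero Bochner_Integration.integrable_sum)
      (auto intro!: divide_nonneg_nonneg sum_nonneg)
  also have "(\<integral>x. (\<Sum>i=1..n. \<bar>r (x i)\<bar>) / real n \<partial>P) = (\<integral>y. \<bar>r y\<bar> \<partial>M)"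
    using n i1 i2 by simp
  finally show ?thesis by (simp add: P_def)
qed

text \<open>Truncation: a bounded part handled by Hoeffding's inequality, and a remainder that is small
  in mean and handled by Markov's inequality.\<close>
lemma weak_law:
  assumes "prob_space M" and f: "integrable M (f :: 'a \<Rightarrow> real)" and e: "0 < e"
  shows "(\<lambda>n. measure (\<Pi>\<^sub>M i\<in>{1..n}. M) {x \<in> space (\<Pi>\<^sub>M i\<in>{1..n}. M).
     e \<le> \<bar>(\<Sum>i=1..n. f (x i)) / real n - (\<integral>y. f y \<partial>M)\<bar>}) \<longlonglongrightarrow> 0"
proof (rule order_tendstoI)
  interpret M: prob_space M by fact
  fix a :: real assume a: "0 < a"
  \<comment> \<open>The bound \<open>e / 3\<close> controls the shift of the mean caused by
    truncation; the bound \<open>a * e / 6\<close> makes the Markov estimate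
    \<open>d / (e / 3)\<close> at most \<open>a / 2\<close>.\<close>
  define d where "d = min (e / 3) (a * e / 6)"
  have d: "0 < d" "d \<le> e / 3" "d \<le> a * e / 6" using a e by (auto simp: d_def)
  obtain g K where g: "integrable M g" "0 < K" "\<And>x. \<bar>g x\<bar> \<le> K" "(\<integral>x. \<bar>f x - g x\<bar> \<partial>M) < d"
    using M.truncation_L1[OF f d(1)] by blast
  have [measurable]: "f \<in> borel_measurable M" "g \<in> borel_measurable M" using f g by auto
  have fg: "integrable M (\<lambda>x. f x - g x)" using f g by auto
  have "\<bar>(\<integral>x. f x \<partial>M) - (\<integral>x. g x \<partial>M)\<bar> = \<bar>\<integral>x. f x - g x \<partial>M\<bar>"
    using f g by simp
  also have "\<dots> \<le> (\<integral>x. \<bar>f x - g x\<bar> \<partial>M)" by (rule integral_abs_bound)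
  finally have mean: "\<bar>(\<integral>x. f x \<partial>M) - (\<integral>x. g x \<partial>M)\<bar> < e / 3" using g(4) d by simp
  have "eventually (\<lambda>n. measure (\<Pi>\<^sub>M i\<in>{1..n}. M) {x \<in> space (\<Pi>\<^sub>M i\<in>{1..n}. M).
     e / 3 \<le> \<bar>(\<Sum>i=1..n. g (x i)) / real n - (\<integral>y. g y \<partial>M)\<bar>} < a / 2) sequentially"
    using a e by (intro order_tendstoD(2)[OF weak_law_bounded[where K = K]] assms g) auto
  then show "eventually (\<lambda>n. measure (\<Pi>\<^sub>M i\<in>{1..n}. M) {x \<in> space (\<Pi>\<^sub>M i\<in>{1..n}. M).
     e \<le> \<bar>(\<Sum>i=1..n. f (x i)) / real n - (\<integral>y. f y \<partial>M)\<bar>} < a) sequentially"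
    using eventually_gt_at_top[of 0]
  proof eventually_elim
    fix n :: nat
    assume A: "measure (\<Pi>\<^sub>M i\<in>{1..n}. M) {x \<in> space (\<Pi>\<^sub>M i\<in>{1..n}. M).
     e / 3 \<le> \<bar>(\<Sum>i=1..n. g (x i)) / real n - (\<integral>y. g y \<partial>M)\<bar>} < a / 2" and n: "0 < n"
    define P where "P = (\<Pi>\<^sub>M i\<in>{1..n}. M)"
    interpret P: prob_space P unfolding P_def using assms by (intro prob_space_PiM)
    have m[measurable]: "(\<lambda>x. x i) \<in> measurable P M" if "i \<in> {1..n}" for i
      using that by (auto simp: P_def)
    have [measurable]: "(\<lambda>x. \<Sum>i=1..n. f (x i)) \<in> borel_measurable P" "(\<lambda>x. \<Sum>i=1..n. g (x i)) \<in> borel_measurable P"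
      "(\<lambda>x. \<Sum>i=1..n. \<bar>f (x i) - g (x i)\<bar>) \<in> borel_measurable P"
      by (auto intro!: borel_measurable_sum)
    let ?A = "{x \<in> space P. e / 3 \<le> \<bar>(\<Sum>i=1..n. g (x i)) / real n - (\<integral>y. g y \<partial>M)\<bar>}"
    let ?B = "{x \<in> space P. e / 3 \<le> (\<Sum>i=1..n. \<bar>f (x i) - g (x i)\<bar>) / real n}"
    have "P.prob {x \<in> space P. e \<le> \<bar>(\<Sum>i=1..n. f (x i)) / real n - (\<integral>y. f y \<partial>M)\<bar>} \<le> P.prob (?A \<union> ?B)"
    proof (intro P.finite_measure_mono subsetI)
      fix x assume "x \<in> {x \<in> space P. e \<le> \<bar>(\<Sum>i=1..n. f (x i)) / real n - (\<integral>y. f y \<partial>M)\<bar>}"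
      then have x: "x \<in> space P" "e \<le> \<bar>(\<Sum>i=1..n. f (x i)) / real n - (\<integral>y. f y \<partial>M)\<bar>" by auto
      have "\<bar>(\<Sum>i=1..n. f (x i)) / real n - (\<Sum>i=1..n. g (x i)) / real n\<bar> = \<bar>\<Sum>i=1..n. f (x i) - g (x i)\<bar> / real n"
        by (simp add: sum_subtractf diff_divide_distrib[symmetric])
      also have "\<dots> \<le> (\<Sum>i=1..n. \<bar>f (x i) - g (x i)\<bar>) / real n"
        by (intro divide_right_mono sum_abs) auto
      finally have fg': "\<bar>(\<Sum>i=1..n. f (x i)) / real n - (\<Sum>i=1..n. g (x i)) / real n\<bar>
          \<le> (\<Sum>i=1..n. \<bar>f (x i) - g (x i)\<bar>) / real n" .
      show "x \<in> ?A \<union> ?B"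
      \<comment> \<open>Outside both events the deviation splits into three parts, from the
        remainder, the truncated average and the means, each below \<open>e / 3\<close>.\<close>
      proof (rule ccontr)
        assume "x \<notin> ?A \<union> ?B"
        then have "\<bar>(\<Sum>i=1..n. g (x i)) / real n - (\<integral>y. g y \<partial>M)\<bar> < e / 3"
            "(\<Sum>i=1..n. \<bar>f (x i) - g (x i)\<bar>) / real n < e / 3"
          using x(1) by (auto simp del: abs_divide)
        with fg' x(2) mean show False by linarith
      qed
    qed measurable
    also have "\<dots> \<le> P.prob ?A + P.prob ?B"
      by (intro measure_Un_le) measurable
    also have "P.prob ?B \<le> (\<integral>x. \<bar>f x - g x\<bar> \<partial>M) / (e / 3)"
      unfolding P_def using e n by (intro mean_Markov_PiM assms fg) auto
    also have "\<dots> \<le> d / (e / 3)"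
      using g(4) e by (intro divide_right_mono) auto
    also have "\<dots> \<le> a / 2" using d e by (simp add: field_simps)
    finally show "measure (\<Pi>\<^sub>M i\<in>{1..n}. M) {x \<in> space (\<Pi>\<^sub>M i\<in>{1..n}. M).
       e \<le> \<bar>(\<Sum>i=1..n. f (x i)) / real n - (\<integral>y. f y \<partial>M)\<bar>} < a"
      using A by (simp add: P_def)
  qed
qed (auto intro!: always_eventually less_le_trans[OF _ measure_nonneg])


section \<open>Empirical measures under the tilted law\<close>

lemma Wp_greater_iff:
  assumes "0 < p" "0 < t"
  shows "ereal t < Wp p \<nu> \<mu> \<longleftrightarrow> ennreal (t powr p) < Tp p \<nu> \<mu>"
proof (cases "Tp p \<nu> \<mu>")
  case (real r)
  have "t < r powr (1 / p) \<longleftrightarrow> t powr p < r"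
  proof
    assume "t < r powr (1 / p)"
    then have "t powr p < (r powr (1 / p)) powr p"
      using assms by (intro powr_less_mono2) auto
    then show "t powr p < r" using assms real by (simp add: powr_powr)
  next
    assume "t powr p < r"
    then have "(t powr p) powr (1 / p) < r powr (1 / p)"
      using assms by (intro powr_less_mono2) auto
    then show "t < r powr (1 / p)" using assms by (simp add: powr_powr)
  qed
  then show ?thesis using real by (simp add: Wp_def ennreal_less_iff)
qed (simp add: Wp_def)

lemma measure_emp:
  assumes n: "0 < n" and [measurable]: "A \<in> sets borel"
  shows "measure (emp n x) A = (\<Sum>i=1..n. indicator A (x i)) / real n"
proof -
  have "emeasure (emp n x) A = (\<integral>\<^sup>+ y. indicator A y \<partial>emp n x)" by simp
  also have "\<dots> = (\<Sum>i=1..n. ennreal (indicator A (x i))) / of_nat n"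
    using n by (subst nn_integral_emp) (auto simp: ennreal_indicator)
  also have "\<dots> = ennreal ((\<Sum>i=1..n. indicator A (x i)) / real n)"
    using n by (simp add: sum_ennreal ennreal_of_nat_eq_real_of_nat divide_ennreal sum_nonneg)
  finally show ?thesis
    by (simp add: measure_def sum_nonneg)
qed

lemma measurable_PiM_borel_component:
  assumes "sets \<nu> = sets borel" "i \<in> I"
  shows "(\<lambda>x. x i) \<in> borel_measurable (\<Pi>\<^sub>M i\<in>I. \<nu>)"
  using measurable_component_singleton[OF assms(2), of "\<lambda>_. \<nu>"]
  by (simp add: measurable_cong_sets[OF refl assms(1)])

text \<open>Lower semicontinuity reduces the claim to a small cost between \<open>\<nu>\<close> and
  \<open>emp n x\<close>. The cell coupling reduces that to finitely many averages, the cell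
  frequencies and the mean quantisation cost, each governed by the weak law.\<close>

lemma Tp_emp_tendsto:
  fixes \<nu> \<mu> :: "'a::{metric_space, second_countable_topology} measure"
  assumes \<nu>: "\<nu> \<in> Pp p" and p: "0 < p" and c: "0 \<le> c" "ennreal c < Tp p \<nu> \<mu>"
  shows "(\<lambda>n. measure (\<Pi>\<^sub>M i\<in>{1..n}. \<nu>)
    {x \<in> space (\<Pi>\<^sub>M i\<in>{1..n}. \<nu>). \<not> ennreal c < Tp p (emp n x) \<mu>}) \<longlonglongrightarrow> 0"
proof -
  have s\<nu>[measurable_cong]: "sets \<nu> = sets borel" and "prob_space \<nu>" using \<nu> by (auto simp: Pp_def)
  interpret \<nu>: prob_space \<nu> by fact
  have sp[simp]: "space \<nu> = UNIV" using s\<nu> by (auto dest: sets_eq_imp_space_eq)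
  obtain x0 where x0: "(\<integral>\<^sup>+ x. ennreal (dist x0 x powr p) \<partial>\<nu>) < \<infinity>"
    using \<nu> by (auto simp: Pp_def)
  obtain \<kappa> :: real where \<kappa>: "0 < \<kappa>" and lsc: "\<And>\<beta> C. prob_space \<beta> \<Longrightarrow> finite C \<Longrightarrow> AE x in \<beta>. x \<in> C \<Longrightarrow>
       Tp p \<nu> \<beta> < ennreal \<kappa> \<Longrightarrow> ennreal c < Tp p \<beta> \<mu>"
    using Tp_lower_semicontinuous[OF \<nu>.prob_space_axioms p c] by blast
  \<comment> \<open>The error budget is four times \<open>\<delta>\<close>: one for quantising
    \<open>\<nu>\<close>, one for the mass moved between cells, two for quantising the sample. The
    factor 8 in place of 4 keeps the inequality strict.\<close>
  define \<delta> where "\<delta> = \<kappa> / (3 powr p * 8)"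
  have \<delta>: "0 < \<delta>" "3 powr p * (4 * \<delta>) < \<kappa>" using \<kappa> by (auto simp: \<delta>_def)
  obtain T where T[measurable]: "T \<in> borel_measurable borel" and finT: "finite (range T)"
    and dT: "(\<integral>\<^sup>+ x. ennreal (dist x (T x) powr p) \<partial>\<nu>) < ennreal \<delta>"
    using finite_range_approximation[OF s\<nu> p x0] \<delta>(1) by (metis ennreal_less_zero_iff)
  have fibre[measurable]: "T -` {a} \<in> sets borel" for a
    using measurable_sets[OF T, of "{a}"] by simp
  define f where "f x = dist x (T x) powr p" for x
  have f[measurable]: "f \<in> borel_measurable borel" by (simp add: f_def[abs_def])
  have f0: "0 \<le> f x" for x by (simp add: f_def)
  have intf: "integrable \<nu> f"
    using dT f0 by (intro integrableI_nonneg) (auto simp: f_def[symmetric] intro: less_trans)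
  have "ennreal (\<integral>x. f x \<partial>\<nu>) < ennreal \<delta>"
    using dT f0 by (subst nn_integral_eq_integral[OF intf, symmetric]) (auto simp: f_def)
  then have Ef: "(\<integral>x. f x \<partial>\<nu>) < \<delta>" using f0 by (simp add: ennreal_less_iff integral_nonneg)
  \<comment> \<open>A sum over all pairs serves as a crude bound for the largest cost between
    representatives.\<close>
  define D where "D = (\<Sum>z\<in>range T \<times> range T. dist (fst z) (snd z) powr p)"
  have D: "dist a b powr p \<le> D" if "a \<in> range T" "b \<in> range T" for a b
    unfolding D_def using that finT
    by (intro order_trans[OF _ member_le_sum[of "(a, b)"]]) auto
  have D0: "0 \<le> D" by (auto simp: D_def intro: sum_nonneg)
  \<comment> \<open>The term \<open>1 / 2\<close> keeps \<open>\<eta>\<close> below 1, and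
    \<open>D + 1\<close> avoids division by zero when \<open>D = 0\<close>.\<close>
  define \<eta> where "\<eta> = min (1 / 2) (\<delta> / (D + 1))"
  have \<eta>: "0 < \<eta>" "\<eta> < 1" "D * \<eta> \<le> \<delta>"
  proof -
    have "D * \<eta> \<le> (D + 1) * (\<delta> / (D + 1))"
      using D0 \<delta> by (intro mult_mono) (auto simp: \<eta>_def)
    then show "D * \<eta> \<le> \<delta>" using D0 by simp
  qed (use D0 \<delta> in \<open>auto simp: \<eta>_def\<close>)
  define w where "w a = measure \<nu> (T -` {a})" for a
  have w: "(\<integral>x. indicator (T -` {a}) x \<partial>\<nu>) = w a" for a by (simp add: w_def)
  \<comment> \<open>The tolerance is relative to the cell mass, as the cell coupling requires. For a
    null cell that requirement is trivial and 1 is just some positive tolerance.\<close>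
  define e where "e a = (if 0 < w a then \<eta> * w a else 1)" for a
  have e: "0 < e a" for a using \<eta> by (simp add: e_def)
  let ?P = "\<lambda>n::nat. \<Pi>\<^sub>M i\<in>{1..n}. \<nu>"
  define U where "U n a = {x \<in> space (?P n). e a \<le> \<bar>(\<Sum>i=1..n. indicator (T -` {a}) (x i)) / real n - w a\<bar>}" for n a
  define V where "V n = {x \<in> space (?P n). \<delta> \<le> \<bar>(\<Sum>i=1..n. f (x i)) / real n - (\<integral>x. f x \<partial>\<nu>)\<bar>}" for n
  have U0: "(\<lambda>n. measure (?P n) (U n a)) \<longlonglongrightarrow> 0" for a
    unfolding U_def w[symmetric] using e
    by (intro weak_law \<nu>.prob_space_axioms integrable_real_indicator)
      (auto simp: s\<nu> fibre \<nu>.emeasure_eq_measure)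
  have V0: "(\<lambda>n. measure (?P n) (V n)) \<longlonglongrightarrow> 0"
    unfolding V_def using \<delta> intf by (intro weak_law \<nu>.prob_space_axioms) auto
  have lim: "(\<lambda>n. (\<Sum>a\<in>range T. measure (?P n) (U n a)) + measure (?P n) (V n)) \<longlonglongrightarrow> 0"
    using tendsto_add[OF tendsto_sum[OF U0] V0] by simp
  have bound: "measure (?P n) {x \<in> space (?P n). \<not> ennreal c < Tp p (emp n x) \<mu>}
      \<le> (\<Sum>a\<in>range T. measure (?P n) (U n a)) + measure (?P n) (V n)" if n: "0 < n" for n
  proof -
    interpret P: prob_space "?P n" using \<nu>.prob_space_axioms by (intro prob_space_PiM)
    have comp[measurable]: "(\<lambda>x. x i) \<in> borel_measurable (?P n)" if "i \<in> {1..n}" for i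
      using s\<nu> that by (rule measurable_PiM_borel_component)
    have U: "U n a \<in> sets (?P n)" for a
    proof -
      have "(\<lambda>x. \<Sum>i=1..n. indicator (T -` {a}) (x i) :: real) \<in> borel_measurable (?P n)"
        by (intro borel_measurable_sum measurable_compose[OF comp]) auto
      then show ?thesis unfolding U_def by measurable
    qed
    then have UT: "(\<Union>a\<in>range T. U n a) \<in> sets (?P n)"
      using finT by (intro sets.finite_UN) auto
    have V: "V n \<in> sets (?P n)"
    proof -
      have "(\<lambda>x. \<Sum>i=1..n. f (x i)) \<in> borel_measurable (?P n)"
        by (intro borel_measurable_sum measurable_compose[OF comp]) auto
      then show ?thesis unfolding V_def by measurable
    qed
    have "{x \<in> space (?P n). \<not> ennreal c < Tp p (emp n x) \<mu>} \<subseteq> (\<Union>a\<in>range T. U n a) \<union> V n"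
    proof (intro subsetI, rule ccontr)
      fix x assume x: "x \<in> {x \<in> space (?P n). \<not> ennreal c < Tp p (emp n x) \<mu>}"
        and not: "x \<notin> (\<Union>a\<in>range T. U n a) \<union> V n"
      have cells: "(1 - \<eta>) * w a \<le> measure (emp n x) (T -` {a})" if "a \<in> range T" for a
      proof (cases "0 < w a")
        case True
        have "\<bar>(\<Sum>i=1..n. indicator (T -` {a}) (x i)) / real n - w a\<bar> < \<eta> * w a"
        proof -
          have "x \<notin> U n a" using not that by blast
          then show ?thesis using x True by (simp add: U_def e_def not_le)
        qed
        then show ?thesis using n by (simp add: measure_emp algebra_simps)
      next
        case False
        then have "w a = 0" by (simp add: w_def zero_less_measure_iff)
        then show ?thesis by simp
      qed
      have "\<bar>(\<Sum>i=1..n. f (x i)) / real n - (\<integral>x. f x \<partial>\<nu>)\<bar> < \<delta>"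
        using not x by (auto simp: V_def not_le)
      then have V_le: "(\<Sum>i=1..n. f (x i)) / real n \<le> 2 * \<delta>"
        using Ef by linarith
      have "(\<integral>\<^sup>+ y. ennreal (f y) \<partial>emp n x) = ennreal ((\<Sum>i=1..n. f (x i)) / real n)"
        using n f0 by (simp add: nn_integral_emp ennreal_of_nat_eq_real_of_nat divide_ennreal sum_nonneg)
      also have "\<dots> \<le> ennreal (2 * \<delta>)" using V_le by (rule ennreal_leI)
      finally have E: "(\<integral>\<^sup>+ y. ennreal (f y) \<partial>emp n x) \<le> ennreal (2 * \<delta>)" .
      have "Tp p \<nu> (emp n x) \<le> ennreal (3 powr p) *
          ((\<integral>\<^sup>+ y. ennreal (dist y (T y) powr p) \<partial>\<nu>) + ennreal (D * \<eta>) + (\<integral>\<^sup>+ y. ennreal (dist y (T y) powr p) \<partial>emp n x))"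
        using \<eta> cells unfolding w_def
        by (intro Tp_le_cells \<nu>.prob_space_axioms prob_space_emp s\<nu> sets_emp T finT p D) auto
      also have "\<dots> \<le> ennreal (3 powr p) * (ennreal \<delta> + ennreal \<delta> + ennreal (2 * \<delta>))"
        using dT E \<eta> by (intro mult_left_mono add_mono) (auto simp: f_def intro: ennreal_leI)
      also have "\<dots> = ennreal (3 powr p * (4 * \<delta>))"
        using \<delta> by (simp add: ennreal_mult[symmetric] ennreal_plus[symmetric] del: ennreal_plus)
      also have "\<dots> < ennreal \<kappa>" using \<delta> \<kappa> by (simp add: ennreal_less_iff)
      finally have "Tp p \<nu> (emp n x) < ennreal \<kappa>" .
      then have "ennreal c < Tp p (emp n x) \<mu>"
        by (intro lsc[OF prob_space_emp _ AE_emp[OF n]]) auto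
      with x show False by simp
    qed
    then have "measure (?P n) {x \<in> space (?P n). \<not> ennreal c < Tp p (emp n x) \<mu>}
        \<le> measure (?P n) ((\<Union>a\<in>range T. U n a) \<union> V n)"
      by (intro P.finite_measure_mono sets.Un UT V)
    also have "\<dots> \<le> measure (?P n) (\<Union>a\<in>range T. U n a) + measure (?P n) (V n)"
      by (intro measure_Un_le UT V)
    also have "measure (?P n) (\<Union>a\<in>range T. U n a) \<le> (\<Sum>a\<in>range T. measure (?P n) (U n a))"
      using finT U by (intro measure_UNION_le) auto
    finally show ?thesis by simp
  qed
  show ?thesis
    by (rule tendsto_sandwich[OF _ eventually_mono[OF eventually_gt_at_top bound] tendsto_const lim]) auto
qed

section \<open>Change of measure and relative entropy\<close>

text \<open>A product measure is determined by its values on rectangles, and there the integral of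
  the product density factorises.\<close>

lemma PiM_density:
  assumes "prob_space M" "finite I" and [measurable]: "F \<in> borel_measurable M"
    and "prob_space (density M F)"
  shows "(\<Pi>\<^sub>M i\<in>I. density M F) = density (\<Pi>\<^sub>M i\<in>I. M) (\<lambda>x. \<Prod>i\<in>I. F (x i))"
proof -
  interpret M: product_prob_space "\<lambda>_. M" I
    using assms(1) by (simp add: product_prob_spaceI)
  interpret N: product_prob_space "\<lambda>_. density M F" I
    using assms(4) by (simp add: product_prob_spaceI)
  have [measurable]: "(\<lambda>x. \<Prod>i\<in>I. F (x i)) \<in> borel_measurable (\<Pi>\<^sub>M i\<in>I. M)"
    by (intro borel_measurable_prod_ennreal) auto
  have "density (\<Pi>\<^sub>M i\<in>I. M) (\<lambda>x. \<Prod>i\<in>I. F (x i)) = (\<Pi>\<^sub>M i\<in>I. density M F)"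
  proof (rule N.PiM_eqI)
    fix A assume "\<And>i. i \<in> I \<Longrightarrow> A i \<in> sets (density M F)"
    then have A[measurable]: "\<And>i. i \<in> I \<Longrightarrow> A i \<in> sets M" by simp
    have "emeasure (density (\<Pi>\<^sub>M i\<in>I. M) (\<lambda>x. \<Prod>i\<in>I. F (x i))) (Pi\<^sub>E I A)
       = (\<integral>\<^sup>+ x. (\<Prod>i\<in>I. F (x i)) * indicator (Pi\<^sub>E I A) x \<partial>(\<Pi>\<^sub>M i\<in>I. M))"
      using assms(2) A by (intro emeasure_density) (auto intro: sets_PiM_I_finite)
    also have "\<dots> = (\<integral>\<^sup>+ x. (\<Prod>i\<in>I. F (x i) * indicator (A i) (x i)) \<partial>(\<Pi>\<^sub>M i\<in>I. M))"
    proof (rule nn_integral_cong)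
      fix x assume "x \<in> space (\<Pi>\<^sub>M i\<in>I. M)"
      then have "indicator (Pi\<^sub>E I A) x = (\<Prod>i\<in>I. indicator (A i) (x i) :: ennreal)"
        using assms(2) by (auto simp: indicator_def space_PiM PiE_iff prod_zero_iff)
      then show "(\<Prod>i\<in>I. F (x i)) * indicator (Pi\<^sub>E I A) x = (\<Prod>i\<in>I. F (x i) * indicator (A i) (x i))"
        by (simp add: prod.distrib)
    qed
    also have "\<dots> = (\<Prod>i\<in>I. \<integral>\<^sup>+ y. F y * indicator (A i) y \<partial>M)"
      using assms(2) by (intro M.product_nn_integral_prod) auto
    also have "\<dots> = (\<Prod>i\<in>I. emeasure (density M F) (A i))"
      by (intro prod.cong refl) (simp add: emeasure_density)
    finally show "emeasure (density (\<Pi>\<^sub>M i\<in>I. M) (\<lambda>x. \<Prod>i\<in>I. F (x i))) (Pi\<^sub>E I A)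
      = (\<Prod>i\<in>I. emeasure (density M F) (A i))" .
  qed (use assms(2) in \<open>auto intro!: sets_PiM_cong\<close>)
  then show ?thesis ..
qed

text \<open>The tilting step: on \<open>B\<close> the product density is at most
  \<open>exp c\<close>. It bounds the probability under the original product law from below.\<close>

lemma measure_PiM_density_le:
  fixes F :: "'a \<Rightarrow> real" and n :: nat
  assumes "prob_space M" and F[measurable]: "F \<in> borel_measurable M" "\<And>x. 0 \<le> F x"
    and d: "prob_space (density M F)"
    and B: "B \<in> sets (\<Pi>\<^sub>M i\<in>{1..n}. M)" "\<And>x. x \<in> B \<Longrightarrow> (\<Sum>i=1..n. ln (F (x i))) \<le> c"
  shows "measure (\<Pi>\<^sub>M i\<in>{1..n}. density M F) B \<le> exp c * measure (\<Pi>\<^sub>M i\<in>{1..n}. M) B"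
proof -
  interpret P: prob_space "\<Pi>\<^sub>M i\<in>{1..n}. M" using assms(1) by (intro prob_space_PiM)
  interpret Q: prob_space "\<Pi>\<^sub>M i\<in>{1..n}. density M F" using d by (intro prob_space_PiM)
  note B(1)[measurable]
  have "emeasure (\<Pi>\<^sub>M i\<in>{1..n}. density M F) B
      = (\<integral>\<^sup>+ x. (\<Prod>i=1..n. ennreal (F (x i))) * indicator B x \<partial>(\<Pi>\<^sub>M i\<in>{1..n}. M))"
    using assms(1) d B(1) by (subst PiM_density) (auto intro!: emeasure_density borel_measurable_prod_ennreal)
  also have "\<dots> \<le> (\<integral>\<^sup>+ x. ennreal (exp c) * indicator B x \<partial>(\<Pi>\<^sub>M i\<in>{1..n}. M))"
  proof (intro nn_integral_mono)
    fix x
    have "(\<Prod>i=1..n. F (x i)) \<le> exp c" if "x \<in> B"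
    proof -
      \<comment> \<open>Only an inequality holds: where \<open>F\<close> vanishes,
        \<open>ln 0 = 0\<close> turns the factor on the right into 1.\<close>
      have "(\<Prod>i=1..n. F (x i)) \<le> (\<Prod>i=1..n. exp (ln (F (x i))))"
      proof (intro prod_mono conjI F(2))
        show "F (x i) \<le> exp (ln (F (x i)))" for i
          using F(2)[of "x i"] by (cases "F (x i) = 0") auto
      qed
      also have "\<dots> = exp (\<Sum>i=1..n. ln (F (x i)))" by (simp add: exp_sum)
      also have "\<dots> \<le> exp c" using B(2)[OF that] by simp
      finally show ?thesis .
    qed
    then show "(\<Prod>i=1..n. ennreal (F (x i))) * indicator B x \<le> ennreal (exp c) * indicator B x"
      using F(2) by (auto simp: prod_ennreal indicator_def intro!: ennreal_leI)
  qed
  also have "\<dots> = ennreal (exp c * measure (\<Pi>\<^sub>M i\<in>{1..n}. M) B)"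
    by (subst nn_integral_cmult_indicator[OF B(1)], subst P.emeasure_eq_measure) (simp add: ennreal_mult)
  finally show ?thesis
    unfolding Q.emeasure_eq_measure by simp
qed

text \<open>The negative part of the log-density always has integral at most 1 under
  \<open>\<nu>\<close>, so finite entropy forces the positive part to be finite too. The entropy is
  then an ordinary integral, to which the weak law applies.\<close>

lemma rel_entropy_finiteE:
  assumes "prob_space \<mu>" "prob_space \<nu>" and fin: "rel_entropy \<nu> \<mu> \<noteq> \<infinity>"
  obtains F :: "'a \<Rightarrow> real" where "F \<in> borel_measurable \<mu>" "\<And>x. 0 \<le> F x" "\<nu> = density \<mu> F"
    "integrable \<nu> (\<lambda>x. ln (F x))" "rel_entropy \<nu> \<mu> = ereal (\<integral>x. ln (F x) \<partial>\<nu>)"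
proof -
  interpret \<mu>: prob_space \<mu> by fact
  interpret \<nu>: prob_space \<nu> by fact
  have ac: "absolutely_continuous \<mu> \<nu>" and s[measurable_cong]: "sets \<nu> = sets \<mu>"
    using fin by (auto simp: rel_entropy_def split: if_splits)
  define F where "F x = enn2real (RN_deriv \<mu> \<nu> x)" for x
  have F[measurable]: "F \<in> borel_measurable \<mu>" by (simp add: F_def[abs_def])
  have F0: "0 \<le> F x" for x by (simp add: F_def)
  have "AE x in \<mu>. RN_deriv \<mu> \<nu> x = ennreal (F x)"
    using \<mu>.RN_deriv_finite[OF \<nu>.sigma_finite_measure_axioms ac s]
    by eventually_elim (auto simp: F_def less_top)
  then have "density \<mu> (RN_deriv \<mu> \<nu>) = density \<mu> F"
    by (intro density_cong) auto
  then have \<nu>: "\<nu> = density \<mu> F" using \<mu>.density_RN_deriv[OF ac s] by simp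
  define A B where "A = (\<integral>\<^sup>+ x. ennreal (ln (F x)) \<partial>\<nu>)" and "B = (\<integral>\<^sup>+ x. ennreal (- ln (F x)) \<partial>\<nu>)"
  have ent: "rel_entropy \<nu> \<mu> = enn2ereal A - enn2ereal B"
    using ac s by (simp add: rel_entropy_def A_def B_def F_def)
  \<comment> \<open>Rewriting over \<open>\<mu>\<close> brings in the factor \<open>F x\<close>, and
    \<open>y * (- ln y) \<le> 1 - y \<le> 1\<close> for \<open>y > 0\<close>, by
    \<open>ln u \<le> u - 1\<close> at \<open>u = 1 / y\<close>.\<close>
  have "B = (\<integral>\<^sup>+ x. ennreal (F x) * ennreal (- ln (F x)) \<partial>\<mu>)"
    unfolding B_def by (subst \<nu>, subst nn_integral_density) auto
  also have "\<dots> \<le> (\<integral>\<^sup>+ x. 1 \<partial>\<mu>)"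
  proof (rule nn_integral_mono)
    fix x
    show "ennreal (F x) * ennreal (- ln (F x)) \<le> 1"
    proof (cases "0 < F x")
      case True
      have "- ln (F x) \<le> 1 / F x - 1"
        using ln_le_minus_one[of "1 / F x"] True by (simp add: ln_div)
      then have "F x * (- ln (F x)) \<le> F x * (1 / F x - 1)"
        using True by (intro mult_left_mono) auto
      then have "F x * (- ln (F x)) \<le> 1" using True by (simp add: algebra_simps)
      then show ?thesis using F0[of x] by (simp add: ennreal_mult'[symmetric] del: mult_minus_right)
    next
      case False
      then have "F x = 0" using F0[of x] by simp
      then show ?thesis by simp
    qed
  qed
  also have "\<dots> = 1" by (simp add: \<mu>.emeasure_space_1)
  finally have B: "B \<noteq> \<infinity>" by (auto simp: top_unique)
  then obtain b where b: "B = ennreal b" "0 \<le> b" by (cases B) auto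
  have A: "A \<noteq> \<infinity>" using fin b by (auto simp: ent)
  then obtain a where a: "A = ennreal a" "0 \<le> a" by (cases A) auto
  have int: "integrable \<nu> (\<lambda>x. ln (F x))"
    using A B by (simp add: real_integrable_def A_def B_def)
  have "rel_entropy \<nu> \<mu> = ereal (\<integral>x. ln (F x) \<partial>\<nu>)"
    unfolding ent real_lebesgue_integral_def[OF int] A_def[symmetric] B_def[symmetric]
    using a b by simp
  with F F0 \<nu> int show thesis by (rule that)
qed


section \<open>Transfer to the random variables and passage to the limit\<close>

text \<open>By independence the joint law of the first \<open>n\<close> variables is the product
  law. Points of the product space are \<open>undefined\<close> outside \<open>{1..n}\<close>,
  unlike the full sequence; \<open>cong\<close> bridges this difference.\<close>

lemma prob_iid_event:
  assumes P: "prob_space P" and X: "\<And>i. X i \<in> borel_measurable P"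
    and \<mu>: "\<And>i. distr P borel (X i) = \<mu>" and ind: "prob_space.indep_vars P (\<lambda>_. borel) X UNIV"
    and n: "0 < (n::nat)" and Q: "{x \<in> space (\<Pi>\<^sub>M i\<in>{1..n}. \<mu>). Q x} \<in> sets (\<Pi>\<^sub>M i\<in>{1..n}. \<mu>)"
    and cong: "\<And>x y. (\<And>i. i \<in> {1..n} \<Longrightarrow> x i = y i) \<Longrightarrow> Q x = Q y"
  shows "measure P {\<omega> \<in> space P. Q (\<lambda>i. X i \<omega>)}
    = measure (\<Pi>\<^sub>M i\<in>{1..n}. \<mu>) {x \<in> space (\<Pi>\<^sub>M i\<in>{1..n}. \<mu>). Q x}"
proof -
  interpret P: prob_space P by fact
  have [simp]: "sets \<mu> = sets borel" using \<mu>[of 0] by auto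
  have "P.indep_vars (\<lambda>_. borel) X {1..n}"
    using ind by (rule P.indep_vars_subset) auto
  then have "distr P (\<Pi>\<^sub>M i\<in>{1..n}. borel) (\<lambda>\<omega>. \<lambda>i\<in>{1..n}. X i \<omega>) = (\<Pi>\<^sub>M i\<in>{1..n}. distr P borel (X i))"
    using n X by (subst (asm) P.indep_vars_iff_distr_eq_PiM) auto
  then have d: "distr P (\<Pi>\<^sub>M i\<in>{1..n}. borel) (\<lambda>\<omega>. \<lambda>i\<in>{1..n}. X i \<omega>) = (\<Pi>\<^sub>M i\<in>{1..n}. \<mu>)"
    by (simp add: \<mu>)
  have m: "(\<lambda>\<omega>. \<lambda>i\<in>{1..n}. X i \<omega>) \<in> measurable P (\<Pi>\<^sub>M i\<in>{1..n}. borel)"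
    using X by (intro measurable_restrict) auto
  have s: "sets (\<Pi>\<^sub>M i\<in>{1..n}. \<mu>) = sets (\<Pi>\<^sub>M i\<in>{1..n}. borel)"
    by (intro sets_PiM_cong) auto
  have "measure (\<Pi>\<^sub>M i\<in>{1..n}. \<mu>) {x \<in> space (\<Pi>\<^sub>M i\<in>{1..n}. \<mu>). Q x}
     = measure P ((\<lambda>\<omega>. \<lambda>i\<in>{1..n}. X i \<omega>) -` {x \<in> space (\<Pi>\<^sub>M i\<in>{1..n}. \<mu>). Q x} \<inter> space P)"
    using Q unfolding s by (subst (1) d[symmetric], subst measure_distr[OF m]) auto
  also have "(\<lambda>\<omega>. \<lambda>i\<in>{1..n}. X i \<omega>) -` {x \<in> space (\<Pi>\<^sub>M i\<in>{1..n}. \<mu>). Q x} \<inter> space P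
      = {\<omega> \<in> space P. Q (\<lambda>i. X i \<omega>)}"
  proof -
    have "Q (\<lambda>i\<in>{1..n}. X i \<omega>) = Q (\<lambda>i. X i \<omega>)" for \<omega>
      by (rule cong) auto
    moreover have "(\<lambda>i\<in>{1..n}. X i \<omega>) \<in> space (\<Pi>\<^sub>M i\<in>{1..n}. \<mu>)" if "\<omega> \<in> space P" for \<omega>
      using measurable_space[OF m that] sets_eq_imp_space_eq[OF s] by simp
    ultimately show ?thesis by auto
  qed
  finally show ?thesis ..
qed

text \<open>After taking logarithms and dividing by \<open>n\<close>, the factor 1/2 costs only
  \<open>ln 2 / n\<close>, which vanishes in the limit.\<close>

lemma liminf_eln_ge:
  assumes "\<And>\<epsilon>. 0 < \<epsilon> \<Longrightarrow> eventually (\<lambda>n. exp (- (real n * (H + \<epsilon>))) / 2 \<le> u n) sequentially"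
  shows "ereal (- H) \<le> liminf (\<lambda>n. ereal (1 / real n) * eln (u n))"
proof (rule ereal_le_epsilon2)
  fix \<epsilon>' :: real assume "0 < \<epsilon>'"
  \<comment> \<open>One half of \<open>\<epsilon>'\<close> pays for the loss in the exponent, the
    other for \<open>ln 2 / n\<close>.\<close>
  define \<epsilon> where "\<epsilon> = \<epsilon>' / 2"
  have \<epsilon>: "0 < \<epsilon>" "\<epsilon>' = 2 * \<epsilon>" using \<open>0 < \<epsilon>'\<close> by (auto simp: \<epsilon>_def)
  have "(\<lambda>n. ln 2 / real n) \<longlonglongrightarrow> 0" by real_asymp
  then have "eventually (\<lambda>n. ln 2 / real n < \<epsilon>) sequentially"
    using \<epsilon> by (intro order_tendstoD) auto
  with assms[OF \<epsilon>(1)] eventually_gt_at_top[of 0]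
  have "eventually (\<lambda>n. ereal (- H - 2 * \<epsilon>) \<le> ereal (1 / real n) * eln (u n)) sequentially"
  proof eventually_elim
    case (elim n)
    then have "0 < u n" by (intro less_le_trans[OF _ elim(1)]) auto
    have "- (real n * (H + \<epsilon>)) - ln 2 = ln (exp (- (real n * (H + \<epsilon>))) / 2)"
      by (simp add: ln_div)
    also have "\<dots> \<le> ln (u n)" using elim \<open>0 < u n\<close> by (subst ln_le_cancel_iff) auto
    finally have "(- (real n * (H + \<epsilon>)) - ln 2) / real n \<le> ln (u n) / real n"
      by (intro divide_right_mono) auto
    moreover have "(- (real n * (H + \<epsilon>)) - ln 2) / real n = - H - \<epsilon> - ln 2 / real n"
      using elim by (simp add: field_simps)
    ultimately have "- H - 2 * \<epsilon> \<le> ln (u n) / real n" using elim by linarith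
    then show ?case using \<open>0 < u n\<close> by (simp add: eln_def)
  qed
  then have "ereal (- H - 2 * \<epsilon>) \<le> liminf (\<lambda>n. ereal (1 / real n) * eln (u n))"
    by (rule Liminf_bounded)
  then have "ereal (- H - 2 * \<epsilon>) + ereal \<epsilon>' \<le> liminf (\<lambda>n. ereal (1 / real n) * eln (u n)) + ereal \<epsilon>'"
    by (rule add_right_mono)
  then show "ereal (- H) \<le> liminf (\<lambda>n. ereal (1 / real n) * eln (u n)) + ereal \<epsilon>'"
    by (simp add: \<epsilon>(2))
qed

text \<open>The tilting estimate is applied to the samples for which the transport cost exceeds
  \<open>c\<close> and the average log-density is within \<open>\<epsilon>\<close> of the entropy.
  Both properties are typical under the product of \<open>\<nu>\<close>.\<close>

lemma Tp_emp_lower_bound: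
  fixes \<nu> \<mu> :: "'a::{metric_space, second_countable_topology} measure"
  assumes \<mu>: "\<mu> \<in> Pp p" and \<nu>: "\<nu> \<in> Pp p" and p: "0 < p" and c: "0 \<le> c" "ennreal c < Tp p \<nu> \<mu>"
    and F[measurable]: "F \<in> borel_measurable \<mu>" "\<And>x. 0 \<le> F x" and d: "\<nu> = density \<mu> F"
    and int: "integrable \<nu> (\<lambda>x. ln (F x))" and \<epsilon>: "0 < \<epsilon>"
  shows "eventually (\<lambda>n. exp (- (real n * ((\<integral>x. ln (F x) \<partial>\<nu>) + \<epsilon>))) / 2
    \<le> measure (\<Pi>\<^sub>M i\<in>{1..n}. \<mu>) {x \<in> space (\<Pi>\<^sub>M i\<in>{1..n}. \<mu>). ennreal c < Tp p (emp n x) \<mu>}) sequentially"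
proof -
  have "prob_space \<mu>" "prob_space \<nu>" and s[measurable_cong]: "sets \<mu> = sets borel" "sets \<nu> = sets borel"
    using \<mu> \<nu> by (auto simp: Pp_def)
  define H where "H = (\<integral>x. ln (F x) \<partial>\<nu>)"
  let ?M = "\<lambda>n::nat. \<Pi>\<^sub>M i\<in>{1..n}. \<mu>" and ?N = "\<lambda>n::nat. \<Pi>\<^sub>M i\<in>{1..n}. \<nu>"
  let ?U = "\<lambda>n. {x \<in> space (?N n). \<not> ennreal c < Tp p (emp n x) \<mu>}"
  let ?V = "\<lambda>n. {x \<in> space (?N n). \<epsilon> \<le> \<bar>(\<Sum>i=1..n. ln (F (x i))) / real n - H\<bar>}"
  have "(\<lambda>n. measure (?N n) (?U n)) \<longlonglongrightarrow> 0"
    using \<nu> p c by (rule Tp_emp_tendsto)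
  \<comment> \<open>Two exceptional events of probability below 1/4 leave at least 1/2 for the good
    event \<open>B\<close>; this is the 1/2 in the conclusion.\<close>
  then have U: "eventually (\<lambda>n. measure (?N n) (?U n) < 1 / 4) sequentially"
    by (rule order_tendstoD) simp
  have "(\<lambda>n. measure (?N n) (?V n)) \<longlonglongrightarrow> 0"
    unfolding H_def using \<open>prob_space \<nu>\<close> int \<epsilon> by (rule weak_law)
  then have V: "eventually (\<lambda>n. measure (?N n) (?V n) < 1 / 4) sequentially"
    by (rule order_tendstoD) simp
  show ?thesis
    using U V eventually_gt_at_top[of 0]
  proof eventually_elim
    case (elim n)
    interpret M: prob_space "?M n" using \<open>prob_space \<mu>\<close> by (intro prob_space_PiM)
    interpret N: prob_space "?N n" using \<open>prob_space \<nu>\<close> by (intro prob_space_PiM)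
    have sMN: "sets (?N n) = sets (?M n)" by (intro sets_PiM_cong) (auto simp: s)
    have comp[measurable]: "(\<lambda>x. x i) \<in> borel_measurable (?N n)" if "i \<in> {1..n}" for i
      using s(2) that by (rule measurable_PiM_borel_component)
    have [measurable]: "F \<in> borel_measurable borel"
      using F(1) by (simp add: measurable_cong_sets[OF s(1) refl])
    have "(\<lambda>x. \<Sum>i=1..n. ln (F (x i))) \<in> borel_measurable (?N n)"
      by (intro borel_measurable_sum) measurable
    then have V': "?V n \<in> sets (?N n)" by measurable
    have "Measurable.pred (?N n) (\<lambda>x. ennreal c < Tp p (emp n x) \<mu>)"
      using elim(3) p c(1) by (intro measurable_Tp_emp comp) auto
    then have U': "?U n \<in> sets (?N n)" "{x \<in> space (?N n). ennreal c < Tp p (emp n x) \<mu>} \<in> sets (?N n)"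
      by measurable
    define B where "B = space (?N n) - (?U n \<union> ?V n)"
    have B': "B \<in> sets (?N n)" unfolding B_def using U' V' by auto
    have "measure (?N n) (?U n \<union> ?V n) \<le> measure (?N n) (?U n) + measure (?N n) (?V n)"
      using U' V' by (intro measure_Un_le) auto
    then have "1 / 2 \<le> measure (?N n) B"
      unfolding B_def using elim U' V' by (subst N.prob_compl) auto
    also have "\<dots> \<le> exp (real n * (H + \<epsilon>)) * measure (?M n) B"
      unfolding d
    proof (rule measure_PiM_density_le)
      show "prob_space (density \<mu> F)" using \<open>prob_space \<nu>\<close> d by simp
      show "B \<in> sets (?M n)" using B' sMN by simp
      show "(\<Sum>i=1..n. ln (F (x i))) \<le> real n * (H + \<epsilon>)" if "x \<in> B" for x
      proof -
        have "\<bar>(\<Sum>i=1..n. ln (F (x i))) / real n - H\<bar> < \<epsilon>" using that by (auto simp: B_def not_le)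
        then have "(\<Sum>i=1..n. ln (F (x i))) / real n \<le> H + \<epsilon>" by linarith
        then show ?thesis using elim(3) by (simp add: divide_le_eq mult.commute)
      qed
    qed (fact F \<open>prob_space \<mu>\<close>)+
    also have "measure (?M n) B \<le> measure (?M n) {x \<in> space (?M n). ennreal c < Tp p (emp n x) \<mu>}"
      using U'(2) sMN sets_eq_imp_space_eq[OF sMN]
      by (intro M.finite_measure_mono) (auto simp: B_def)
    finally have "exp (- (real n * (H + \<epsilon>))) * (1 / 2) \<le> exp (- (real n * (H + \<epsilon>))) *
        (exp (real n * (H + \<epsilon>)) * measure (?M n) {x \<in> space (?M n). ennreal c < Tp p (emp n x) \<mu>})"
      by (intro mult_left_mono) auto
    then show ?case
      by (simp add: mult.assoc[symmetric] exp_add[symmetric] H_def del: mult_minus_left mult_minus_right)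
  qed
qed

theorem theorem2p2:
  fixes p t :: real and \<mu> :: "('a::polish_space) measure"
    and P :: "'b measure" and X :: "nat \<Rightarrow> 'b \<Rightarrow> 'a"
  assumes "p \<ge> 1" and "\<mu> \<in> Pp p"
    and "prob_space P"
    and "\<And>i. X i \<in> measurable P borel"
    and "\<And>i. distr P borel (X i) = \<mu>"
    and "prob_space.indep_vars P (\<lambda>_. borel) X UNIV"
    and "t > 0"
  shows "liminf (\<lambda>n. ereal (1 / real n) *
            eln (measure P {\<omega> \<in> space P. Wp p (empirical X n \<omega>) \<mu> > ereal t}))
         \<ge> - (INF \<nu>\<in>{\<nu> \<in> Pp p. Wp p \<nu> \<mu> > ereal t}. rel_entropy \<nu> \<mu>)"
  (is "?L \<ge> _")
proof -
  have p: "0 < p" using \<open>p \<ge> 1\<close> by simp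
  have \<mu>: "prob_space \<mu>" "sets \<mu> = sets borel" using \<open>\<mu> \<in> Pp p\<close> by (auto simp: Pp_def)
  \<comment> \<open>Each competitor \<open>\<nu>\<close> gives its own lower bound, and the supremum
    is taken at the end. For infinite entropy the bound is minus infinity and hence trivial.\<close>
  have "- rel_entropy \<nu> \<mu> \<le> ?L" if \<nu>: "\<nu> \<in> Pp p" "ereal t < Wp p \<nu> \<mu>" for \<nu>
  proof (cases "rel_entropy \<nu> \<mu> = \<infinity>")
    case False
    have "prob_space \<nu>" using \<nu> by (auto simp: Pp_def)
    obtain F :: "'a \<Rightarrow> real" where F: "F \<in> borel_measurable \<mu>" "\<And>x. 0 \<le> F x" "\<nu> = density \<mu> F"
      "integrable \<nu> (\<lambda>x. ln (F x))" and ent: "rel_entropy \<nu> \<mu> = ereal (\<integral>x. ln (F x) \<partial>\<nu>)"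
      using rel_entropy_finiteE[OF \<mu>(1) \<open>prob_space \<nu>\<close> False] by blast
    have gt: "ennreal (t powr p) < Tp p \<nu> \<mu>"
      using \<nu>(2) p \<open>t > 0\<close> by (simp add: Wp_greater_iff)
    have "ereal (- (\<integral>x. ln (F x) \<partial>\<nu>)) \<le> ?L"
    proof (rule liminf_eln_ge)
      fix \<epsilon> :: real assume "0 < \<epsilon>"
      have "eventually (\<lambda>n. exp (- (real n * ((\<integral>x. ln (F x) \<partial>\<nu>) + \<epsilon>))) / 2
        \<le> measure (\<Pi>\<^sub>M i\<in>{1..n}. \<mu>) {x \<in> space (\<Pi>\<^sub>M i\<in>{1..n}. \<mu>). ennreal (t powr p) < Tp p (emp n x) \<mu>}) sequentially"
        using \<open>\<mu> \<in> Pp p\<close> \<nu>(1) p powr_ge_zero gt F \<open>0 < \<epsilon>\<close> by (rule Tp_emp_lower_bound)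
      then show "eventually (\<lambda>n. exp (- (real n * ((\<integral>x. ln (F x) \<partial>\<nu>) + \<epsilon>))) / 2
        \<le> measure P {\<omega> \<in> space P. Wp p (empirical X n \<omega>) \<mu> > ereal t}) sequentially"
        using eventually_gt_at_top[of 0]
      proof eventually_elim
        case (elim n)
        have "measure P {\<omega> \<in> space P. ennreal (t powr p) < Tp p (emp n (\<lambda>i. X i \<omega>)) \<mu>}
          = measure (\<Pi>\<^sub>M i\<in>{1..n}. \<mu>) {x \<in> space (\<Pi>\<^sub>M i\<in>{1..n}. \<mu>). ennreal (t powr p) < Tp p (emp n x) \<mu>}"
        proof (rule prob_iid_event[OF assms(3-6) elim(2)])
          have "Measurable.pred (\<Pi>\<^sub>M i\<in>{1..n}. \<mu>) (\<lambda>x. ennreal (t powr p) < Tp p (emp n x) \<mu>)"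
            using elim(2) p by (intro measurable_Tp_emp measurable_PiM_borel_component[OF \<mu>(2)]) auto
          then show "{x \<in> space (\<Pi>\<^sub>M i\<in>{1..n}. \<mu>). ennreal (t powr p) < Tp p (emp n x) \<mu>} \<in> sets (\<Pi>\<^sub>M i\<in>{1..n}. \<mu>)"
            by measurable
          show "(ennreal (t powr p) < Tp p (emp n x) \<mu>) = (ennreal (t powr p) < Tp p (emp n y) \<mu>)"
            if "\<And>i. i \<in> {1..n} \<Longrightarrow> x i = y i" for x y
            using emp_cong[OF elim(2) that] by simp
        qed
        with elim(1) show ?case
          using p \<open>t > 0\<close> by (simp add: Wp_greater_iff empirical_eq_emp)
      qed
    qed
    then show ?thesis by (simp add: ent)
  qed simp
  then have "(SUP \<nu>\<in>{\<nu> \<in> Pp p. Wp p \<nu> \<mu> > ereal t}. - rel_entropy \<nu> \<mu>) \<le> ?L"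
    by (intro SUP_least) auto
  \<comment> \<open>The negative of an infimum is the supremum of the negatives, also when no
    competitor exists.\<close>
  then show ?thesis by (simp add: ereal_INF_uminus_eq ereal_SUP_uminus_eq)
qed

end
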